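(* Assume (A). There exists a function $f_\epsilon(t)=o_t(1)$ (depending on the constant $\epsilon$ in (A)) such that, whenever $d\ge (np)^{1+f_\epsilon(np)}$, no polynomial of degree at most $D=(\log n)^{5/4}/(\log\log n)$ in the edge indicators distinguishes $\mathsf{G}(n,p)$ from $\mathsf{RGG}(n,\mathbb{T}^d,\mathsf{Unif},\sigma^\infty_p,p)$; i.e., for every such polynomial $f$, $$\big|\mathbf{E}_{\mathsf{RGG}}f(\mathbf{G})-\mathbf{E}_{\mathsf{G}(n,p)}f(\mathbf{G})\big| = o\Big(\sqrt{\mathrm{Var}_{\mathsf{G}(n,p)}f+\mathrm{Var}_{\mathsf{RGG}}f}\Big).$$
   Context: Torus $\mathbb{T}^d=\mathbb{R}^d/2\mathbb{Z}^d$ with uniform measure; circular distance $|x-y|_C\in[0,1]$ on a circle of circumference 2; $\|\mathbf{x}-\mathbf{y}\|_\infty=\max_i|x_i-y_i|_C$; $\tau^\infty_p$ satisfies $\mathbf{P}[\|\mathbf{x}-\mathbf{y}\|_\infty\le\tau^\infty_p]=p$ for iid uniform $\mathbf{x},\mathbf{y}$. $\mathsf{RGG}(n,\mathbb{T}^d,\mathsf{Unif},\sigma^\infty_p,p)$: iid uniform latent points $\mathbf{x}^1,\dots,\mathbf{x}^n$, edge $ij$ iff $\|\mathbf{x}^i-\mathbf{x}^j\|_\infty\le\tau^\infty_p$. $\mathsf{G}(n,p)$ is Erdős–Rényi. Assumption (A): absolute constants $\delta,\epsilon>0$ with $n^{-1+\epsilon}\le p\le1/2$ and $n^\delta\le d$.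 Polynomials are real polynomials in the $\binom n2$ edge indicator variables. *)

theory Defs
  imports "HOL-Probability.Probability"
begin

text \<open>Torus T^d = R^d / 2Z^d, represented by the fundamental domain [0,2)^d with the
uniform (normalized Lebesgue) measure; points are functions nat => real, coordinates k < d.\<close>

definition circ_dist :: "real \<Rightarrow> real \<Rightarrow> real" where
  "circ_dist a b = (let t = frac (\<bar>a - b\<bar> / 2) in 2 * min t (1 - t))"

definition linf_dist :: "nat \<Rightarrow> (nat \<Rightarrow> real) \<Rightarrow> (nat \<Rightarrow> real) \<Rightarrow> real" where
  "linf_dist d x y = Max ((\<lambda>k. circ_dist (x k) (y k)) ` {..<d})"

definition torus_unif :: "nat \<Rightarrow> (nat \<Rightarrow> real) measure" where
  "torus_unif d = PiM {..<d} (\<lambda>_. uniform_measure lborel {0..<2::real})"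

definition tau_inf :: "nat \<Rightarrow> real \<Rightarrow> real" where
  "tau_inf d p = (THE \<tau>. measure (torus_unif d \<Otimes>\<^sub>M torus_unif d)
      {z \<in> space (torus_unif d \<Otimes>\<^sub>M torus_unif d). linf_dist d (fst z) (snd z) \<le> \<tau>} = p)"

definition all_edges :: "nat \<Rightarrow> (nat \<times> nat) set" where
  "all_edges n = {(i, j). i < j \<and> j < n}"

definition rgg_graph :: "nat \<Rightarrow> nat \<Rightarrow> real \<Rightarrow> (nat \<Rightarrow> nat \<Rightarrow> real) \<Rightarrow> (nat \<times> nat) set" where
  "rgg_graph n d \<tau> X = {e \<in> all_edges n. linf_dist d (X (fst e)) (X (snd e)) \<le> \<tau>}"

definition latent :: "nat \<Rightarrow> nat \<Rightarrow> (nat \<Rightarrow> nat \<Rightarrow> real) measure" where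
  "latent n d = PiM {..<n} (\<lambda>_. torus_unif d)"

definition E_rgg :: "nat \<Rightarrow> nat \<Rightarrow> real \<Rightarrow> ((nat \<times> nat) set \<Rightarrow> real) \<Rightarrow> real" where
  "E_rgg n d p F = (\<integral>X. F (rgg_graph n d (tau_inf d p) X) \<partial>latent n d)"

definition Var_rgg :: "nat \<Rightarrow> nat \<Rightarrow> real \<Rightarrow> ((nat \<times> nat) set \<Rightarrow> real) \<Rightarrow> real" where
  "Var_rgg n d p F = E_rgg n d p (\<lambda>G. (F G)\<^sup>2) - (E_rgg n d p F)\<^sup>2"

definition E_gnp :: "nat \<Rightarrow> real \<Rightarrow> ((nat \<times> nat) set \<Rightarrow> real) \<Rightarrow> real" where
  "E_gnp n p F = (\<Sum>G\<in>Pow (all_edges n).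
      p ^ card G * (1 - p) ^ (card (all_edges n) - card G) * F G)"

definition Var_gnp :: "nat \<Rightarrow> real \<Rightarrow> ((nat \<times> nat) set \<Rightarrow> real) \<Rightarrow> real" where
  "Var_gnp n p F = E_gnp n p (\<lambda>G. (F G)\<^sup>2) - (E_gnp n p F)\<^sup>2"

text \<open>Polynomial of degree at most D in the edge indicators, with coefficient function c
(multilinear form: on 0/1 inputs every polynomial of degree <= D agrees with one of these).\<close>
definition edge_poly :: "nat \<Rightarrow> real \<Rightarrow> ((nat \<times> nat) set \<Rightarrow> real) \<Rightarrow> (nat \<times> nat) set \<Rightarrow> real" where
  "edge_poly n D c G = (\<Sum>S\<in>{S. S \<subseteq> all_edges n \<and> real (card S) \<le> D}.
      c S * (\<Prod>e\<in>S. indicator G e))"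

definition low_deg :: "nat \<Rightarrow> real" where
  "low_deg n = (ln (real n)) powr (5/4) / ln (ln (real n))"

end

theory Submission
  imports Defs "HOL-Real_Asymp.Real_Asymp"
begin

text \<open>
  By Cauchy--Schwarz it suffices that the squared normalised Fourier coefficients
  \<open>E_rgg (\<Prod>e\<in>H. 1[e\<in>G] - p)\<close> over graphs \<open>H\<close> with at most \<open>D\<close> edges sum to \<open>o(1)\<close>.
  An edge is present iff it is present in each of the \<open>d\<close> coordinates, where it fails only if its
  endpoints are almost antipodal, an event of probability \<open>q = 1 - p^(1/d) \<le> ln n / d\<close>. Hence the
  coefficient of \<open>H\<close> is \<open>p^|H|\<close> times the Moebius coefficient at \<open>H\<close> of \<open>S \<mapsto> R(S)^d\<close>, where \<open>R\<close> has the
  one-coordinate Moebius coefficients \<open>\<beta>(T)\<close>. These vanish when \<open>T\<close> has a leaf, and a forest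
  inside \<open>T\<close> with at least \<open>v(T)/2 + 1\<close> edges gives \<open>|\<beta>(T)| \<le> 8^|T| q^(v(T)/2 + 1)\<close>; the only leafless
  graph without such a forest is the triangle, for which three failures exclude each other.
  A weighted norm that is submultiplicative under unions bounds the coefficients of \<open>R^d\<close> by
  \<open>(q n^o(1))^(v(H)/2)\<close>. A graph on \<open>v\<close> vertices with at most \<open>D\<close> edges has at most \<open>v \<surd>D\<close> edges, so
  all counting losses are \<open>exp(O(v \<surd>D ln ln n)) = n^(v o(1))\<close>, and \<open>n p q n^o(1) \<rightarrow> 0\<close> finishes the proof.
\<close>

section \<open>Leafless graphs, forests and union convolutions\<close>

definition verts :: "(nat \<times> nat) set \<Rightarrow> nat set" where
  "verts T = fst ` T \<union> snd ` T"

text \<open>Minimum degree two on \<open>verts T\<close>, phrased edgewise so that closure under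
  unions is immediate. That closure lets it serve as the support condition \<open>P\<close> in
  \<open>power_union_convolution\<close>.\<close>

definition leafless :: "(nat \<times> nat) set \<Rightarrow> bool" where
  "leafless T \<longleftrightarrow> (\<forall>e\<in>T. \<forall>v\<in>{fst e, snd e}. \<exists>e'\<in>T. e' \<noteq> e \<and> v \<in> {fst e', snd e'})"

definition edge :: "nat \<Rightarrow> nat \<Rightarrow> nat \<times> nat" where
  "edge u v = (min u v, max u v)"

text \<open>Each new edge has an endpoint \<open>v\<close> untouched so far, while \<open>u\<close>
  may be old or new. Read backwards, the construction is an order in which the vertices
  \<open>v\<close> can be integrated out one at a time.\<close>

inductive forest :: "(nat \<times> nat) set \<Rightarrow> bool" where
  forest_empty: "forest {}"
| forest_insert: "forest F \<Longrightarrow> u \<noteq> v \<Longrightarrow> v \<notin> verts F \<Longrightarrow> forest (insert (edge u v) F)"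

lemma verts_empty [simp]: "verts {} = {}"
  by (simp add: verts_def)

lemma verts_insert [simp]: "verts (insert e T) = insert (fst e) (insert (snd e) (verts T))"
  by (auto simp: verts_def)

lemma verts_Un: "verts (S \<union> T) = verts S \<union> verts T"
  by (auto simp: verts_def)

lemma verts_mono: "S \<subseteq> T \<Longrightarrow> verts S \<subseteq> verts T"
  by (auto simp: verts_def)

lemma finite_verts [simp]: "finite T \<Longrightarrow> finite (verts T)"
  by (simp add: verts_def)

lemma verts_eq_empty_iff [simp]: "verts T = {} \<longleftrightarrow> T = {}"
  by (auto simp: verts_def)

lemma endpoints_in_verts: "e \<in> T \<Longrightarrow> fst e \<in> verts T" "e \<in> T \<Longrightarrow> snd e \<in> verts T"
  by (auto simp: verts_def)

lemma subset_verts_Times: "T \<subseteq> verts T \<times> verts T"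
  by (force simp: verts_def)

lemma edge_commute: "edge u v = edge v u"
  by (simp add: edge_def min.commute max.commute)

lemma endpoints_edge [simp]: "insert (fst (edge u v)) (insert (snd (edge u v)) A) = insert u (insert v A)"
  by (auto simp: edge_def min_def max_def)

lemma edge_in_all_edges: "e \<in> all_edges n \<Longrightarrow> e = edge (fst e) (snd e) \<and> fst e \<noteq> snd e"
  by (auto simp: all_edges_def edge_def)

lemma finite_all_edges [simp]: "finite (all_edges n)"
  by (rule finite_subset[of _ "{..<n} \<times> {..<n}"]) (auto simp: all_edges_def)

lemma finite_subset_all_edges: "T \<subseteq> all_edges n \<Longrightarrow> finite T"
  by (rule finite_subset) auto

lemma verts_all_edges: "T \<subseteq> all_edges n \<Longrightarrow> verts T \<subseteq> {..<n}"
  by (fastforce simp: verts_def all_edges_def)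

lemma edge_eq_iff: "edge a b = edge c d \<longleftrightarrow> (a = c \<and> b = d) \<or> (a = d \<and> b = c)"
  by (auto simp: edge_def min_def max_def split: if_splits)

lemma leafless_Un: "leafless S \<Longrightarrow> leafless T \<Longrightarrow> leafless (S \<union> T)"
  unfolding leafless_def by blast

lemma leafless_empty: "leafless {}"
  by (simp add: leafless_def)

text \<open>With v vertices, either v is at most s and the trivial count v * v suffices, or v
  exceeds s and the hypothesis s * s does. Taking s close to the square root of the degree bound, a
  graph has at most s edges per vertex.\<close>

lemma card_edges_le_verts:
  assumes "finite T" "card T \<le> s\<^sup>2"
  shows "card T \<le> card (verts T) * s"
proof (cases "card (verts T) \<le> s")
  case True
  have "card T \<le> card (verts T \<times> verts T)"
    using assms subset_verts_Times by (intro card_mono) auto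
  also have "\<dots> \<le> card (verts T) * s"
    using True by (simp add: card_cartesian_product)
  finally show ?thesis .
next
  case False
  then have "s * s \<le> card (verts T) * s" by (intro mult_right_mono) auto
  then show ?thesis using assms(2) unfolding power2_eq_square by linarith
qed

text \<open>Double counting of incidences: every vertex meets at least two edges, every edge has at
  most two endpoints.\<close>

lemma leafless_card_verts_le:
  assumes "finite T" "leafless T"
  shows "card (verts T) \<le> card T"
proof -
  let ?inc = "\<lambda>v. {e\<in>T. v \<in> {fst e, snd e}}"
  have two: "2 \<le> card (?inc v)" if "v \<in> verts T" for v
  proof -
    from that obtain e where e: "e \<in> T" "v \<in> {fst e, snd e}"
      by (auto simp: verts_def)
    with assms(2) obtain e' where e': "e' \<in> T" "e' \<noteq> e" "v \<in> {fst e', snd e'}"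
      unfolding leafless_def by blast
    have "card {e, e'} \<le> card (?inc v)"
      using e e' assms(1) by (intro card_mono) auto
    then show ?thesis using e' by simp
  qed
  have "2 * card (verts T) = (\<Sum>v\<in>verts T. 2)" by simp
  also have "\<dots> \<le> (\<Sum>v\<in>verts T. card (?inc v))"
    by (rule sum_mono) (rule two)
  also have "\<dots> = (\<Sum>v\<in>verts T. \<Sum>e\<in>T. if v \<in> {fst e, snd e} then 1 else 0)"
    using assms(1) by (intro sum.cong refl) (simp add: sum.If_cases Int_def)
  also have "\<dots> = (\<Sum>e\<in>T. \<Sum>v\<in>verts T. if v \<in> {fst e, snd e} then 1 else 0)"
    by (rule sum.swap)
  also have "\<dots> = (\<Sum>e\<in>T. card (verts T \<inter> {fst e, snd e}))"
    using assms(1) by (intro sum.cong refl) (simp add: sum.If_cases Int_def)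
  also have "\<dots> \<le> (\<Sum>e\<in>T. 2)"
  proof (rule sum_mono)
    fix e assume "e \<in> T"
    have "card (verts T \<inter> {fst e, snd e}) \<le> card {fst e, snd e}" by (intro card_mono) auto
    also have "\<dots> \<le> 2" by (simp add: card_insert_if)
    finally show "card (verts T \<inter> {fst e, snd e}) \<le> 2" .
  qed
  finally show ?thesis by simp
qed

section \<open>Forests with many edges inside leafless graphs\<close>

lemma forest_finite: "forest F \<Longrightarrow> finite F"
  by (induction rule: forest.induct) auto

text \<open>A new edge either attaches one new vertex to the forest or starts a new tree with two new
  vertices, so \<open>2 * card F - card (verts F)\<close> never decreases while the forest is completed to a
  spanning one.\<close>

lemma forest_extend_spanning:
  assumes T: "finite T" "\<And>e. e \<in> T \<Longrightarrow> \<exists>u v. u \<noteq> v \<and> e = edge u v"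
    and F: "forest F" "F \<subseteq> T" "card (verts F) + k \<le> 2 * card F"
  shows "\<exists>F'. forest F' \<and> F' \<subseteq> T \<and> card (verts T) + k \<le> 2 * card F'"
  using F
proof (induction "card (verts T - verts F)" arbitrary: F rule: less_induct)
  case less
  show ?case
  proof (cases "verts T \<subseteq> verts F")
    case True
    then have "verts T = verts F" using verts_mono[OF less.prems(2)] by auto
    with less.prems show ?thesis by auto
  next
    case False
    then obtain v where v: "v \<in> verts T" "v \<notin> verts F" by auto
    then obtain e where e: "e \<in> T" "v = fst e \<or> v = snd e" by (auto simp: verts_def)
    obtain a b where ab: "a \<noteq> b" "e = edge a b" using T(2)[OF e(1)] by auto
    have "v = a \<or> v = b"
      using e(2) ab by (auto simp: edge_def min_def max_def split: if_splits)
    then have "\<exists>u. u \<noteq> v \<and> e = edge u v"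
      using ab edge_commute[of a b] by auto
    then obtain u where u: "u \<noteq> v" "e = edge u v" by auto
    let ?F = "insert e F"
    have fin: "finite F" using less.prems(1) forest_finite by auto
    have forest: "forest ?F" unfolding u(2) using less.prems(1) u(1) v(2) by (rule forest_insert)
    have ve: "verts ?F = insert u (insert v (verts F))" by (simp add: u(2))
    have "e \<notin> F" using v(2) e(2) endpoints_in_verts by blast
    then have card: "card ?F = card F + 1" using fin by simp
    have "card (verts ?F) \<le> card (verts F) + 2"
      unfolding ve using fin by (simp add: card_insert_if)
    with card less.prems(3) have pot: "card (verts ?F) + k \<le> 2 * card ?F" by linarith
    have smaller: "card (verts T - verts ?F) < card (verts T - verts F)"
      using v T(1) unfolding ve by (intro psubset_card_mono) auto
    have "?F \<subseteq> T" using e(1) less.prems(2) by auto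
    then show ?thesis by (rule less.hyps[OF smaller forest _ pot])
  qed
qed

lemma forest_two_edge_path:
  assumes "b \<noteq> a" "c \<noteq> a" "c \<noteq> b"
  shows "forest {edge c a, edge b a}"
proof -
  have "forest (insert (edge b a) {})" by (rule forest_insert[OF forest_empty]) (use assms in auto)
  then have "forest (insert (edge a c) {edge b a})"
    by (rule forest_insert) (use assms in auto)
  then show ?thesis by (simp add: edge_commute)
qed

text \<open>The seed of the spanning forest is a tree on four vertices or a pair of disjoint two-edge
  paths; a triangle is the only leafless graph containing neither.\<close>

lemma leafless_has_large_forest:
  assumes T: "finite T" "\<And>e. e \<in> T \<Longrightarrow> \<exists>u v. u \<noteq> v \<and> e = edge u v"
    and "leafless T" "T \<noteq> {}"
    and not_tri: "\<And>a b c. a \<noteq> b \<Longrightarrow> a \<noteq> c \<Longrightarrow> b \<noteq> c \<Longrightarrow> T \<noteq> {edge a b, edge b c, edge a c}"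
  shows "\<exists>F. forest F \<and> F \<subseteq> T \<and> card (verts T) + 2 \<le> 2 * card F"
proof -
  \<comment> \<open>A walk that reaches \<open>v\<close> along \<open>edge u v\<close> can leave
    \<open>v\<close> towards a vertex other than \<open>u\<close>.\<close>
  have nbr: "\<exists>w. w \<noteq> v \<and> w \<noteq> u \<and> edge w v \<in> T" if "edge u v \<in> T" "u \<noteq> v" for u v
  proof -
    have "v \<in> {fst (edge u v), snd (edge u v)}" by (auto simp: edge_def)
    with that(1) \<open>leafless T\<close> obtain e where e: "e \<in> T" "e \<noteq> edge u v" "v \<in> {fst e, snd e}"
      unfolding leafless_def by blast
    obtain a b where ab: "a \<noteq> b" "e = edge a b" using T(2)[OF e(1)] by auto
    then have "v = a \<or> v = b" using e(3) by (auto simp: edge_def min_def max_def split: if_splits)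
    then show ?thesis
    proof
      assume "v = a"
      then show ?thesis using e ab edge_commute[of a b] by (intro exI[of _ b]) auto
    next
      assume "v = b"
      then show ?thesis using e ab by (intro exI[of _ a]) auto
    qed
  qed
  have seed: "\<exists>F. forest F \<and> F \<subseteq> T \<and> card (verts T) + 2 \<le> 2 * card F"
    if "forest F" "F \<subseteq> T" "card (verts F) + 2 \<le> 2 * card F" for F
    using forest_extend_spanning[OF T that] by auto
  obtain a b where ab: "edge b a \<in> T" "b \<noteq> a" using T(2) \<open>T \<noteq> {}\<close> by blast
  obtain c where c: "c \<noteq> a" "c \<noteq> b" "edge c a \<in> T" using nbr[OF ab] by auto
  have path: "forest {edge c a, edge b a}" using ab c by (intro forest_two_edge_path) auto
  \<comment> \<open>If an edge leaves \<open>{a, b, c}\<close>, it extends the path to a tree with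
    four vertices and three edges, and 4 + 2 = 2 * 3.\<close>
  show ?thesis
  proof (cases "\<exists>x y. x \<notin> {a, b, c} \<and> y \<in> {a, b, c} \<and> edge y x \<in> T")
    case True
    then obtain x y where xy: "x \<notin> {a, b, c}" "y \<in> {a, b, c}" "edge y x \<in> T" by auto
    have "forest (insert (edge y x) {edge c a, edge b a})"
      using path by (rule forest_insert) (use xy in auto)
    moreover have "card (insert (edge y x) {edge c a, edge b a}) = 3"
      using xy ab c by (auto simp: edge_eq_iff card_insert_if)
    moreover have "card (verts (insert (edge y x) {edge c a, edge b a})) \<le> card {a, b, c, x}"
      using xy by (intro card_mono) auto
    moreover have "card {a, b, c, x} \<le> 4" by (simp add: card_insert_if)
    ultimately show ?thesis
      using xy ab c by (intro seed[of "insert (edge y x) {edge c a, edge b a}"]) auto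
  next
    case False
    \<comment> \<open>No edge joins \<open>{a, b, c}\<close> to the rest, so leaflessness forces the
      full triangle on it. As \<open>T\<close> is more than this triangle, an edge lies elsewhere
      and continues to a second two-edge path: six vertices, four edges, and 6 + 2 = 2 * 4.\<close>
    then have closed: "\<And>x y. edge y x \<in> T \<Longrightarrow> y \<in> {a, b, c} \<Longrightarrow> x \<in> {a, b, c}" by blast
    have "edge a b \<in> T" using ab by (simp add: edge_commute)
    then obtain w where w: "w \<noteq> b" "w \<noteq> a" "edge w b \<in> T" using nbr[of a b] ab by auto
    then have "w = c" using closed[of b w] by (auto simp: edge_commute)
    then have tri: "{edge a b, edge b c, edge a c} \<subseteq> T"
      using w ab c by (auto simp: edge_commute)
    with not_tri[of a b c] ab c obtain e where e: "e \<in> T" "e \<notin> {edge a b, edge b c, edge a c}"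
      by auto
    obtain a' b' where ab': "e = edge b' a'" "b' \<noteq> a'" using T(2)[OF e(1)] by auto
    have out: "a' \<notin> {a, b, c}" "b' \<notin> {a, b, c}"
      using closed[of b' a'] closed[of a' b'] e ab' by (auto simp: edge_commute)
    obtain c' where c': "c' \<noteq> a'" "c' \<noteq> b'" "edge c' a' \<in> T" using nbr[of b' a'] ab' e by auto
    have out': "c' \<notin> {a, b, c}" using closed[of c' a'] out c' by auto
    let ?F1 = "insert (edge b' a') {edge c a, edge b a}"
    let ?F2 = "insert (edge a' c') ?F1"
    have "forest ?F1" using path by (rule forest_insert) (use out ab' in auto)
    then have "forest ?F2" by (rule forest_insert) (use out out' c' in auto)
    moreover have "card ?F2 = 4"
      using out out' c' ab c ab' by (auto simp: edge_eq_iff card_insert_if)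
    moreover have "card (verts ?F2) \<le> card {a, b, c, a', b', c'}"
      by (intro card_mono) auto
    moreover have "card {a, b, c, a', b', c'} \<le> 6" by (simp add: card_insert_if)
    ultimately show ?thesis
      using ab' e c c' ab by (intro seed[of ?F2]) (auto simp: edge_commute)
  qed
qed

text \<open>Pointwise products correspond to union convolutions of Moebius coefficients, hence a norm
  weighted by a function that is submultiplicative under unions is an algebra norm.\<close>

lemma power_union_convolution:
  fixes \<beta> w :: "'a set \<Rightarrow> real"
  assumes H: "finite H"
    and w: "\<And>S. 0 \<le> w S" "w {} = 1" "\<And>S T. S \<subseteq> H \<Longrightarrow> T \<subseteq> H \<Longrightarrow> w (S \<union> T) \<le> w S * w T"
    and P: "P {}" "\<And>S T. P S \<Longrightarrow> P T \<Longrightarrow> P (S \<union> T)" "\<And>T. T \<subseteq> H \<Longrightarrow> \<not> P T \<Longrightarrow> \<beta> T = 0"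
  shows "\<exists>\<beta>'. (\<forall>S\<subseteq>H. (\<Sum>T\<in>Pow S. \<beta> T) ^ d = (\<Sum>T\<in>Pow S. \<beta>' T)) \<and>
    (\<forall>T\<subseteq>H. \<not> P T \<longrightarrow> \<beta>' T = 0) \<and>
    (\<Sum>T\<in>Pow H. \<bar>\<beta>' T\<bar> * w T) \<le> (\<Sum>T\<in>Pow H. \<bar>\<beta> T\<bar> * w T) ^ d"
proof (induction d)
  case 0
  have "(\<Sum>T\<in>Pow S. if T = {} then 1 else 0 :: real) = 1" if "S \<subseteq> H" for S
    using finite_subset[OF that H] by (simp add: sum.delta)
  moreover have "(\<Sum>T\<in>Pow H. \<bar>if T = {} then 1 else 0\<bar> * w T) = (\<Sum>T\<in>Pow H. if T = {} then 1 else 0)"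
    by (intro sum.cong) (auto simp: w(2))
  ultimately show ?case
    using H P(1) by (intro exI[of _ "\<lambda>T. if T = {} then 1 else 0"]) auto
next
  case (Suc d)
  then obtain \<beta>' where b: "\<And>S. S \<subseteq> H \<Longrightarrow> (\<Sum>T\<in>Pow S. \<beta> T) ^ d = (\<Sum>T\<in>Pow S. \<beta>' T)"
    "\<And>T. T \<subseteq> H \<Longrightarrow> \<not> P T \<Longrightarrow> \<beta>' T = 0"
    "(\<Sum>T\<in>Pow H. \<bar>\<beta>' T\<bar> * w T) \<le> (\<Sum>T\<in>Pow H. \<bar>\<beta> T\<bar> * w T) ^ d" by blast
  define \<beta>'' where
    "\<beta>'' W = (\<Sum>(U, V)\<in>{z \<in> Pow H \<times> Pow H. fst z \<union> snd z = W}. \<beta> U * \<beta>' V)" for W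
  have "(\<Sum>T\<in>Pow S. \<beta> T) ^ Suc d = (\<Sum>T\<in>Pow S. \<beta>'' T)" if S: "S \<subseteq> H" for S
  proof -
    have fS: "finite S" using S H finite_subset by auto
    have "(\<Sum>T\<in>Pow S. \<beta>'' T) =
        (\<Sum>T\<in>Pow S. \<Sum>(U, V)\<in>{z \<in> Pow S \<times> Pow S. fst z \<union> snd z = T}. \<beta> U * \<beta>' V)"
      unfolding \<beta>''_def using S by (intro sum.cong) auto
    also have "\<dots> = (\<Sum>(U, V)\<in>Pow S \<times> Pow S. \<beta> U * \<beta>' V)"
      using fS by (intro sum.group) auto
    also have "\<dots> = (\<Sum>T\<in>Pow S. \<beta> T) * (\<Sum>T\<in>Pow S. \<beta>' T)"
      by (simp add: sum_product sum.cartesian_product)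
    finally show ?thesis using b(1)[OF S] by simp
  qed
  moreover have "\<beta>'' T = 0" if "T \<subseteq> H" "\<not> P T" for T
    unfolding \<beta>''_def
  proof (rule sum.neutral, clarsimp)
    fix U V assume "U \<subseteq> H" "V \<subseteq> H" "T = U \<union> V" "\<beta>' V \<noteq> 0"
    then show "\<beta> U = 0" using that P b(2) by blast
  qed
  moreover have "(\<Sum>T\<in>Pow H. \<bar>\<beta>'' T\<bar> * w T) \<le> (\<Sum>T\<in>Pow H. \<bar>\<beta> T\<bar> * w T) ^ Suc d"
  proof -
    have "(\<Sum>T\<in>Pow H. \<bar>\<beta>'' T\<bar> * w T) \<le>
        (\<Sum>T\<in>Pow H. \<Sum>(U, V)\<in>{z \<in> Pow H \<times> Pow H. fst z \<union> snd z = T}.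
          (\<bar>\<beta> U\<bar> * w U) * (\<bar>\<beta>' V\<bar> * w V))"
    proof (rule sum_mono)
      fix T assume "T \<in> Pow H"
      let ?Z = "{z \<in> Pow H \<times> Pow H. fst z \<union> snd z = T}"
      have "\<bar>\<beta>'' T\<bar> * w T \<le> (\<Sum>(U, V)\<in>?Z. \<bar>\<beta> U * \<beta>' V\<bar>) * w T"
        unfolding \<beta>''_def using w(1)
        by (intro mult_right_mono order_trans[OF sum_abs] sum_mono) auto
      also have "\<dots> = (\<Sum>(U, V)\<in>?Z. \<bar>\<beta> U * \<beta>' V\<bar> * w T)"
        by (simp add: sum_distrib_right case_prod_unfold)
      also have "\<dots> \<le> (\<Sum>(U, V)\<in>?Z. (\<bar>\<beta> U\<bar> * w U) * (\<bar>\<beta>' V\<bar> * w V))"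
      proof (rule sum_mono, clarsimp)
        fix U V assume "U \<subseteq> H" "V \<subseteq> H" "T = U \<union> V"
        then have "\<bar>\<beta> U * \<beta>' V\<bar> * w (U \<union> V) \<le> \<bar>\<beta> U * \<beta>' V\<bar> * (w U * w V)"
          using w(3) by (intro mult_left_mono) auto
        then show "\<bar>\<beta> U * \<beta>' V\<bar> * w (U \<union> V) \<le> \<bar>\<beta> U\<bar> * w U * (\<bar>\<beta>' V\<bar> * w V)"
          by (simp add: abs_mult mult_ac)
      qed
      finally show "\<bar>\<beta>'' T\<bar> * w T \<le> (\<Sum>(U, V)\<in>?Z. (\<bar>\<beta> U\<bar> * w U) * (\<bar>\<beta>' V\<bar> * w V))" .
    qed
    also have "\<dots> = (\<Sum>(U, V)\<in>Pow H \<times> Pow H. (\<bar>\<beta> U\<bar> * w U) * (\<bar>\<beta>' V\<bar> * w V))"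
      using H by (intro sum.group) auto
    also have "\<dots> = (\<Sum>T\<in>Pow H. \<bar>\<beta> T\<bar> * w T) * (\<Sum>T\<in>Pow H. \<bar>\<beta>' T\<bar> * w T)"
      by (simp add: sum_product sum.cartesian_product)
    also have "\<dots> \<le> (\<Sum>T\<in>Pow H. \<bar>\<beta> T\<bar> * w T) * (\<Sum>T\<in>Pow H. \<bar>\<beta> T\<bar> * w T) ^ d"
      using b(3) w(1) by (intro mult_left_mono sum_nonneg) auto
    finally show ?thesis by simp
  qed
  ultimately show ?case by blast
qed

section \<open>Norm bounds for Moebius coefficients and sums over leafless graphs\<close>

lemma sum_Pow_power_card:
  fixes y :: real
  assumes "finite A"
  shows "(\<Sum>T\<in>Pow A. y ^ card T) = (1 + y) ^ card A"
  using prod_add[OF assms, of "\<lambda>_. y" "\<lambda>_. 1"] by (simp add: add.commute)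

lemma exp_diff_le: "0 \<le> x \<Longrightarrow> x \<le> 1 \<Longrightarrow> exp x - 1 \<le> 2 * (x::real)"
  using exp_bound[of x] mult_left_le[of x x] by (simp add: power2_eq_square)

text \<open>The weight is \<open>W ^ card (verts T)\<close> with \<open>1 / W = r * (16 * L * D) ^ s\<close>: as \<open>card T \<le> s * card (verts T)\<close>,
  the factor \<open>(16 * L * D) ^ s\<close> per vertex absorbs both \<open>8 ^ card T\<close> and the number of subgraphs.\<close>

lemma mobius_power_bound:
  fixes \<beta> :: "(nat \<times> nat) set \<Rightarrow> real"
  assumes H: "finite H" "real (card H) \<le> D" "D \<ge> 1" "D \<le> (real s)\<^sup>2"
    and \<beta>: "\<beta> {} = 1" "\<And>T. T \<subseteq> H \<Longrightarrow> \<not> leafless T \<Longrightarrow> \<beta> T = 0"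
      "\<And>T. T \<subseteq> H \<Longrightarrow> leafless T \<Longrightarrow> T \<noteq> {} \<Longrightarrow> \<bar>\<beta> T\<bar> \<le> 8 ^ card T * r ^ (card (verts T) + 2)"
    and r: "0 < r" "real d * r\<^sup>2 \<le> L" "L \<ge> 1" "r * (16 * L * D) ^ s \<le> 1"
  shows "(\<not> leafless H \<longrightarrow> (\<Sum>S\<in>Pow H. (-1) ^ (card H - card S) * (\<Sum>T\<in>Pow S. \<beta> T) ^ d) = 0) \<and>
    \<bar>\<Sum>S\<in>Pow H. (-1) ^ (card H - card S) * (\<Sum>T\<in>Pow S. \<beta> T) ^ d\<bar>
      \<le> exp 1 * (r * (16 * L * D) ^ s) ^ card (verts H)"
proof -
  define Y where "Y = (16 * L * D) ^ s"
  \<comment> \<open>\<open>8 / y\<close> is the base of the power \<open>Y\<close>. At the same time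
    \<open>y * card H \<le> 1 / (2 * L)\<close>, so summing \<open>y ^ card T\<close> over nonempty
    subgraphs gives at most \<open>1 / L\<close>.\<close>
  define y where "y = 1 / (2 * L * D)"
  define W where "W = 1 / (r * Y)"
  have LD: "L * D \<ge> 1" using H r mult_mono[of 1 L 1 D] by simp
  have y: "0 < y" "y \<le> 1" using LD by (auto simp: y_def mult.assoc)
  have Y: "Y = (8 / y) ^ s" by (simp add: Y_def y_def algebra_simps)
  have Ypos: "Y > 0" using y by (simp add: Y)
  have W1: "W \<ge> 1" using r Ypos by (simp add: W_def Y_def)
  define w where "w T = W ^ card (verts T)" for T :: "(nat \<times> nat) set"
  have w: "w (S \<union> T) \<le> w S * w T" for S T
  proof -
    have "card (verts S \<union> verts T) \<le> card (verts S) + card (verts T)" by (rule card_Un_le)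
    then show ?thesis
      unfolding w_def verts_Un power_add[symmetric] using W1 by (rule power_increasing)
  qed
  have "\<exists>\<beta>'. (\<forall>S\<subseteq>H. (\<Sum>T\<in>Pow S. \<beta> T) ^ d = (\<Sum>T\<in>Pow S. \<beta>' T)) \<and>
    (\<forall>T\<subseteq>H. \<not> leafless T \<longrightarrow> \<beta>' T = 0) \<and>
    (\<Sum>T\<in>Pow H. \<bar>\<beta>' T\<bar> * w T) \<le> (\<Sum>T\<in>Pow H. \<bar>\<beta> T\<bar> * w T) ^ d"
    using H W1 w \<beta> leafless_Un leafless_empty
    by (intro power_union_convolution) (auto simp: w_def)
  then obtain \<beta>' where b: "\<And>S. S \<subseteq> H \<Longrightarrow> (\<Sum>T\<in>Pow S. \<beta> T) ^ d = (\<Sum>T\<in>Pow S. \<beta>' T)"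
    "\<And>T. T \<subseteq> H \<Longrightarrow> \<not> leafless T \<Longrightarrow> \<beta>' T = 0"
    "(\<Sum>T\<in>Pow H. \<bar>\<beta>' T\<bar> * w T) \<le> (\<Sum>T\<in>Pow H. \<bar>\<beta> T\<bar> * w T) ^ d" by blast
  \<comment> \<open>The alternating sum is Moebius inversion of the d-th power, so it picks out its
    coefficient at \<open>H\<close>.\<close>
  have mob: "(\<Sum>S\<in>Pow H. (-1) ^ (card H - card S) * (\<Sum>T\<in>Pow S. \<beta> T) ^ d) = \<beta>' H"
    using inclusion_exclusion_mobius[of "\<lambda>S. sum \<beta>' (Pow S)" \<beta>' H] H(1)
    by (simp add: b(1))
  have bnd: "\<bar>\<beta> T\<bar> * w T \<le> r\<^sup>2 * y ^ card T" if T: "T \<in> Pow H - {{}}" for T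
  proof (cases "leafless T")
    case False
    then show ?thesis using \<beta>(2)[of T] T y by simp
  next
    case True
    let ?v = "card (verts T)"
    have fT: "finite T" using T H(1) finite_subset by auto
    have "card T \<le> card H" using T H(1) by (intro card_mono) auto
    then have "real (card T) \<le> (real s)\<^sup>2" using H by linarith
    then have "card T \<le> s\<^sup>2" by (metis of_nat_le_iff of_nat_power)
    then have cT: "card T \<le> ?v * s" using fT by (intro card_edges_le_verts)
    have "(8 / y) ^ card T \<le> (8 / y) ^ (?v * s)"
      using y cT by (intro power_increasing) (auto simp: field_simps)
    also have "\<dots> = Y ^ ?v" by (simp add: Y power_mult mult.commute)
    finally have eY: "8 ^ card T \<le> y ^ card T * Y ^ ?v"
      using y by (simp add: power_divide divide_le_eq mult.commute)
    have "\<bar>\<beta> T\<bar> * w T \<le> 8 ^ card T * r ^ (?v + 2) * w T"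
      using \<beta>(3)[of T] T True W1 by (intro mult_right_mono) (auto simp: w_def)
    also have "\<dots> \<le> (y ^ card T * Y ^ ?v) * r ^ (?v + 2) * w T"
      using eY r W1 by (intro mult_right_mono) (auto simp: w_def)
    also have "\<dots> = r\<^sup>2 * y ^ card T"
      using r Ypos by (simp add: w_def W_def power_divide power_add power_mult_distrib power2_eq_square)
    finally show ?thesis .
  qed
  \<comment> \<open>One coefficient is at most the whole weighted norm; dividing a constant norm
    bound by \<open>w H\<close> leaves the decay in \<open>card (verts H)\<close>.\<close>
  have "\<bar>\<beta>' H\<bar> * w H \<le> (\<Sum>T\<in>Pow H. \<bar>\<beta>' T\<bar> * w T)"
    using H(1) W1 by (intro member_le_sum) (auto simp: w_def)
  also have "\<dots> \<le> (\<Sum>T\<in>Pow H. \<bar>\<beta> T\<bar> * w T) ^ d" by (rule b(3))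
  also have "\<dots> \<le> exp 1"
  proof -
    have yD: "y * card H \<le> y * D" using H y by (intro mult_left_mono) auto
    have yD': "y * D = 1 / (2 * L)" using H by (simp add: y_def)
    have yD1: "y * card H \<le> 1" 
    proof -
      have "1 / (2 * L) \<le> 1" using r by simp
      then show ?thesis using yD yD' by linarith
    qed
    \<comment> \<open>The empty graph contributes 1 and all others together at most
      \<open>r\<^sup>2 / L\<close>. Hence \<open>d * r\<^sup>2 \<le> L\<close> keeps the d-th power
      below \<open>exp 1\<close>.\<close>
    have "(\<Sum>T\<in>Pow H. \<bar>\<beta> T\<bar> * w T) = 1 + (\<Sum>T\<in>Pow H - {{}}. \<bar>\<beta> T\<bar> * w T)"
      using H(1) by (subst sum.remove[of _ "{}"]) (auto simp: \<beta>(1) w_def)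
    also have "\<dots> \<le> 1 + (\<Sum>T\<in>Pow H - {{}}. r\<^sup>2 * y ^ card T)"
      using bnd by (intro add_left_mono sum_mono) auto
    also have "(\<Sum>T\<in>Pow H - {{}}. r\<^sup>2 * y ^ card T) = r\<^sup>2 * ((1 + y) ^ card H - 1)"
      using H(1) by (simp add: sum_distrib_left[symmetric] sum_diff1 sum_Pow_power_card)
    also have "\<dots> \<le> r\<^sup>2 * (exp (y * card H) - 1)"
    proof -
      have "(1 + y) ^ card H \<le> exp y ^ card H"
        using y by (intro power_mono exp_ge_add_one_self) auto
      also have "\<dots> = exp (y * card H)" by (simp add: exp_of_nat_mult[symmetric] mult.commute)
      finally show ?thesis by (intro mult_left_mono) auto
    qed
    also have "\<dots> \<le> r\<^sup>2 * (2 * (y * card H))"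
      using y yD1 by (intro mult_left_mono exp_diff_le) auto
    also have "\<dots> \<le> r\<^sup>2 * (1 / L)"
      using yD yD' r by (intro mult_left_mono) auto
    finally have "(\<Sum>T\<in>Pow H. \<bar>\<beta> T\<bar> * w T) \<le> 1 + r\<^sup>2 / L" by simp
    also have "\<dots> \<le> exp (r\<^sup>2 / L)" by (rule exp_ge_add_one_self)
    finally have "(\<Sum>T\<in>Pow H. \<bar>\<beta> T\<bar> * w T) ^ d \<le> exp (r\<^sup>2 / L) ^ d"
      using W1 by (intro power_mono sum_nonneg) (auto simp: w_def)
    also have "\<dots> = exp (real d * (r\<^sup>2 / L))" by (rule exp_of_nat_mult[symmetric])
    also have "\<dots> \<le> exp 1" using r by (simp add: field_simps)
    finally show ?thesis .
  qed
  finally have "\<bar>\<beta>' H\<bar> * w H \<le> exp 1" .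
  moreover have "w H > 0" using W1 by (simp add: w_def)
  ultimately have "\<bar>\<beta>' H\<bar> \<le> exp 1 / w H" by (simp add: field_simps)
  also have "\<dots> = exp 1 * (r * Y) ^ card (verts H)"
    by (simp add: w_def W_def power_divide)
  finally show ?thesis unfolding mob using b(2)[of H] by (simp add: Y_def)
qed

text \<open>Graphs are grouped by vertex set \<open>V\<close> of size v. With
  \<open>B = D\<^sup>2\<close>, the factor \<open>B ^ (v * s) * (1 / B) ^ card H\<close> is at least
  1, and summing it over all subsets of \<open>V \<times> V\<close> costs only
  \<open>(1 + 1 / B) ^ (v * v) \<le> exp 1\<close>, because leaflessness gives v <= card H <= D. The
  sum over \<open>V\<close> is then binomial.\<close>

lemma sum_leafless_bound:
  fixes x D :: real
  assumes "x \<ge> 0" "D \<ge> 1" "D \<le> (real s)\<^sup>2"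
  shows "(\<Sum>H | H \<subseteq> all_edges n \<and> real (card H) \<le> D \<and> H \<noteq> {} \<and> leafless H. x ^ card (verts H))
    \<le> exp (real n * (x * (exp 1 * (D\<^sup>2) ^ s))) - 1"
proof -
  let ?\<H> = "{H. H \<subseteq> all_edges n \<and> real (card H) \<le> D \<and> H \<noteq> {} \<and> leafless H}"
  define B where "B = D\<^sup>2"
  have B1: "B \<ge> 1" using assms by (simp add: B_def)
  have fin: "finite ?\<H>" by (rule finite_subset[of _ "Pow (all_edges n)"]) auto
  have count: "(\<Sum>H | H \<in> ?\<H> \<and> verts H = V. x ^ card (verts H)) \<le> (x * (exp 1 * B ^ s)) ^ card V"
    if V: "V \<in> Pow {..<n} - {{}}" for V
  proof (cases "{H. H \<in> ?\<H> \<and> verts H = V} = {}")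
    case True
    then show ?thesis using assms B1 by (simp del: Collect_empty_eq)
  next
    case False
    let ?v = "card V"
    from False obtain H where H: "H \<in> ?\<H>" "verts H = V" by auto
    have fV: "finite V" using V finite_subset by auto
    have cV: "?v \<ge> 1" using V fV by (simp add: Suc_le_eq card_gt_0_iff)
    have "?v \<le> card H"
      using H leafless_card_verts_le[of H] finite_subset[of H "all_edges n"] by auto
    then have "real ?v \<le> D" using H by auto
    then have vB: "(real ?v)\<^sup>2 \<le> B" unfolding B_def by (intro power_mono) auto
    have "(\<Sum>H | H \<in> ?\<H> \<and> verts H = V. x ^ card (verts H)) = (\<Sum>H | H \<in> ?\<H> \<and> verts H = V. x ^ ?v)"
      by (intro sum.cong) auto
    also have "\<dots> \<le> (\<Sum>H | H \<in> ?\<H> \<and> verts H = V. x ^ ?v * (B ^ (?v * s) * (1 / B) ^ card H))"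
    proof (rule sum_mono)
      fix H assume H: "H \<in> {H. H \<in> ?\<H> \<and> verts H = V}"
      have "real (card H) \<le> D" using H by auto
      then have "real (card H) \<le> (real s)\<^sup>2" using assms(3) by linarith
      then have le: "card H \<le> s\<^sup>2" by (metis of_nat_le_iff of_nat_power)
      have "finite H" using H finite_subset[of H "all_edges n"] by auto
      then have "card H \<le> ?v * s" using H le card_edges_le_verts[of H s] by auto
      then have "B ^ card H \<le> B ^ (?v * s)" using B1 by (intro power_increasing)
      then have "1 \<le> B ^ (?v * s) * (1 / B) ^ card H"
        using B1 by (simp add: power_divide field_simps)
      then show "x ^ ?v \<le> x ^ ?v * (B ^ (?v * s) * (1 / B) ^ card H)"
        using assms(1) by (intro mult_le_cancel_left1[THEN iffD2]) (auto simp: not_le)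
    qed
    also have "\<dots> \<le> (\<Sum>H\<in>Pow (V \<times> V). x ^ ?v * (B ^ (?v * s) * (1 / B) ^ card H))"
      using fV assms B1 subset_verts_Times by (intro sum_mono2) auto
    also have "\<dots> = x ^ ?v * B ^ (?v * s) * (1 + 1 / B) ^ (?v * ?v)"
      using fV sum_Pow_power_card[of "V \<times> V" "1 / B"]
      by (simp add: sum_distrib_left[symmetric] mult.assoc card_cartesian_product)
    also have "\<dots> \<le> x ^ ?v * B ^ (?v * s) * exp 1 ^ ?v"
    proof -
      have "(1 + 1 / B) ^ (?v * ?v) \<le> exp (1 / B) ^ (?v * ?v)"
        using B1 by (intro power_mono exp_ge_add_one_self) auto
      also have "\<dots> = exp ((real ?v)\<^sup>2 / B)"
        by (simp add: exp_of_nat_mult[symmetric] power2_eq_square)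
      also have "\<dots> \<le> exp 1" using vB B1 by (simp add: field_simps)
      also have "\<dots> \<le> exp 1 ^ ?v" using cV by (intro self_le_power) auto
      finally show ?thesis using assms B1 by (intro mult_left_mono) auto
    qed
    also have "\<dots> = (x * (exp 1 * B ^ s)) ^ ?v"
      by (simp add: power_mult_distrib power_mult[symmetric] mult_ac)
    finally show ?thesis .
  qed
  have "(\<Sum>H\<in>?\<H>. x ^ card (verts H)) =
      (\<Sum>V\<in>Pow {..<n} - {{}}. \<Sum>H | H \<in> ?\<H> \<and> verts H = V. x ^ card (verts H))"
  proof (rule sum.group[symmetric])
    show "verts ` ?\<H> \<subseteq> Pow {..<n} - {{}}" using verts_all_edges by auto
  qed (use fin in auto)
  also have "\<dots> \<le> (\<Sum>V\<in>Pow {..<n} - {{}}. (x * (exp 1 * B ^ s)) ^ card V)"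
    by (rule sum_mono) (rule count)
  also have "\<dots> = (1 + x * (exp 1 * B ^ s)) ^ n - 1"
    by (simp add: sum_diff1 sum_Pow_power_card)
  also have "\<dots> \<le> exp (x * (exp 1 * B ^ s)) ^ n - 1"
    using assms B1 by (intro diff_right_mono power_mono exp_ge_add_one_self) (auto intro!: add_nonneg_nonneg)
  also have "\<dots> = exp (real n * (x * (exp 1 * B ^ s))) - 1"
    by (simp only: exp_of_nat_mult)
  finally show ?thesis unfolding B_def .
qed

section \<open>One coordinate\<close>

abbreviation circle :: "real measure" where
  "circle \<equiv> uniform_measure lborel {0..<2::real}"

lemma prob_space_circle: "prob_space circle"
  by (rule prob_space_uniform_measure) auto

lemma sets_circle [measurable_cong]: "sets circle = sets borel"
  by simp

section \<open>Circular distance: symmetry, reduction modulo 2 and the measure of arcs\<close>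

lemma circ_dist_alt: "circ_dist a b = 2 * min (frac ((a - b) / 2)) (1 - frac ((a - b) / 2))"
proof -
  have "min (frac (- u)) (1 - frac (- u)) = min (frac u) (1 - frac u)" for u :: real
    proof (cases "u \<in> \<int>")
    case True
    then have "frac u = 0" "frac (- u) = 0" by (simp_all add: frac_eq_0_iff)
    then show ?thesis by (simp only:)
  qed (auto simp: frac_neg min_def)
  from this[of "(a - b) / 2"] show ?thesis
    unfolding circ_dist_def Let_def by (cases "a \<ge> b") (auto simp: minus_divide_left abs_if)
qed

lemma circ_dist_commute: "circ_dist a b = circ_dist b a"
  by (simp add: circ_dist_def abs_minus_commute)

text \<open>The space of \<open>circle\<close> is the whole real line, so pointwise facts must also
  hold off \<open>{0..<2}\<close>; reduction modulo 2 carries them over from the fundamental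
  domain.\<close>

lemma circ_dist_reduce: "circ_dist (2 * frac (a / 2)) b = circ_dist a b"
proof -
  have "(2 * frac (a / 2) - b) / 2 = (a - b) / 2 + of_int (- \<lfloor>a / 2\<rfloor>)"
    by (simp add: frac_def field_simps)
  then show ?thesis
    unfolding circ_dist_alt by (metis frac_add_of_int_right)
qed

lemma circ_dist_reduce': "circ_dist a (2 * frac (b / 2)) = circ_dist a b"
  using circ_dist_reduce[of b a] by (simp only: circ_dist_commute[of a])

lemma circ_dist_fundamental:
  assumes "a \<in> {0..<2}" "b \<in> {0..<2}"
  shows "circ_dist a b = min \<bar>a - b\<bar> (2 - \<bar>a - b\<bar>)"
proof -
  have "frac (\<bar>a - b\<bar> / 2) = \<bar>a - b\<bar> / 2"
    using assms by (subst frac_eq) (auto simp: abs_if)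
  then show ?thesis by (simp add: circ_dist_def min_def field_simps)
qed

lemma circ_dist_bounds: "0 \<le> circ_dist a b" "circ_dist a b \<le> 1"
  using frac_ge_0[of "(a - b) / 2"] frac_lt_1[of "(a - b) / 2"]
  unfolding circ_dist_alt min_def by (auto simp: not_le)

text \<open>Three points cut the circle into three arcs of total length 2, and each distance is at
  most the corresponding arc. This is what forbids three pairwise almost antipodal points.\<close>

lemma circ_dist_perimeter: "circ_dist a b + circ_dist b c + circ_dist a c \<le> 2"
proof -
  have *: "circ_dist a b + circ_dist b c + circ_dist a c \<le> 2"
    if "a \<in> {0..<2}" "b \<in> {0..<2}" "c \<in> {0..<2}" for a b c
    unfolding circ_dist_fundamental[OF that(1,2)] circ_dist_fundamental[OF that(2,3)]
      circ_dist_fundamental[OF that(1,3)]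
    by linarith
  have "2 * frac (x / 2) \<in> {0..<2}" for x :: real
    using frac_ge_0[of "x / 2"] frac_lt_1[of "x / 2"] by auto
  from *[OF this[of a] this[of b] this[of c]] show ?thesis
    by (simp only: circ_dist_reduce circ_dist_reduce')
qed

lemma borel_measurable_circ_dist [measurable (raw)]:
  assumes "f \<in> borel_measurable M" "g \<in> borel_measurable M"
  shows "(\<lambda>x. circ_dist (f x) (g x)) \<in> borel_measurable M"
proof -
  have [measurable]: "(frac :: real \<Rightarrow> real) \<in> borel_measurable borel"
    unfolding frac_def[abs_def] by measurable
  show ?thesis
    unfolding circ_dist_alt using assms by measurable
qed

text \<open>The far points form an arc of length \<open>2 - 2 * \<tau>\<close> centred at the
  antipode of \<open>a\<close>. Cut open at 0, it is a single interval to the right or to the left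
  of \<open>a'\<close>, or wraps around, hence three cases. That the value does not depend on
  \<open>a\<close> is what makes vertices removable one at a time.\<close>

lemma measure_circ_dist_gt:
  assumes "0 \<le> \<tau>" "\<tau> \<le> 1"
  shows "measure circle {y. circ_dist a y > \<tau>} = 1 - \<tau>"
proof -
  define a' where "a' = 2 * frac (a / 2)"
  have a': "0 \<le> a'" "a' < 2"
    using frac_ge_0[of "a / 2"] frac_lt_1[of "a / 2"] by (auto simp: a'_def)
  have eq: "{0..<2} \<inter> {y. circ_dist a y > \<tau>} =
      {0..<2} \<inter> ({a' + \<tau><..<a' + 2 - \<tau>} \<union> {a' - 2 + \<tau><..<a' - \<tau>})"
  proof (intro set_eqI)
    fix y
    show "y \<in> {0..<2} \<inter> {y. circ_dist a y > \<tau>} \<longleftrightarrow>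
      y \<in> {0..<2} \<inter> ({a' + \<tau><..<a' + 2 - \<tau>} \<union> {a' - 2 + \<tau><..<a' - \<tau>})"
    proof (cases "y \<in> {0..<2}")
      case True
      then have "circ_dist a y = min \<bar>a' - y\<bar> (2 - \<bar>a' - y\<bar>)"
        using circ_dist_fundamental[of a' y] a' circ_dist_reduce[of a y] by (simp add: a'_def)
      then show ?thesis using True assms by (auto simp: min_def abs_if)
    qed auto
  qed
  have "measure lborel ({0..<2} \<inter> {y. circ_dist a y > \<tau>}) = 2 - 2 * \<tau>"
  proof -
    consider "a' \<le> \<tau>" | "a' > \<tau>" "a' + \<tau> \<ge> 2" | "a' > \<tau>" "a' + \<tau> < 2" by linarith
    then show ?thesis
    proof cases
      case 1
      then have "{0..<2} \<inter> ({a' + \<tau><..<a' + 2 - \<tau>} \<union> {a' - 2 + \<tau><..<a' - \<tau>})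
          = {a' + \<tau><..<a' + 2 - \<tau>}"
        using assms a' by auto
      then show ?thesis unfolding eq using assms by simp
    next
      case 2
      then have "{0..<2} \<inter> ({a' + \<tau><..<a' + 2 - \<tau>} \<union> {a' - 2 + \<tau><..<a' - \<tau>})
          = {a' - 2 + \<tau><..<a' - \<tau>}"
        using assms a' by auto
      then show ?thesis unfolding eq using assms by simp
    next
      case 3
      then have "{0..<2} \<inter> ({a' + \<tau><..<a' + 2 - \<tau>} \<union> {a' - 2 + \<tau><..<a' - \<tau>})
          = {a' + \<tau><..<2} \<union> {0..<a' - \<tau>}"
        using assms a' by auto
      moreover have "measure lborel ({a' + \<tau><..<2} \<union> {0..<a' - \<tau>}) =
          measure lborel {a' + \<tau><..<2} + measure lborel {0..<a' - \<tau>}"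
        using assms 3 by (intro measure_Union) auto
      ultimately show ?thesis unfolding eq using assms 3 by simp
    qed
  qed
  moreover have "{y. circ_dist a y > \<tau>} \<in> sets lborel" by measurable
  ultimately show ?thesis by (simp add: field_simps)
qed

lemma measure_circ_dist_le:
  assumes "0 \<le> \<tau>" "\<tau> \<le> 1"
  shows "measure circle {y. circ_dist a y \<le> \<tau>} = \<tau>"
proof -
  interpret prob_space circle by (rule prob_space_circle)
  have "{y. circ_dist a y \<le> \<tau>} = space circle - {y. circ_dist a y > \<tau>}" by auto
  moreover have "{y. circ_dist a y > \<tau>} \<in> events" by measurable
  ultimately show ?thesis using prob_compl measure_circ_dist_gt[OF assms] by simp
qed

text \<open>Per coordinate, an edge is present unless its endpoints are almost antipodal, which happens
  with probability \<open>q\<close>; \<open>dev q\<close> is the centred indicator of presence.\<close>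

definition dev :: "real \<Rightarrow> nat \<times> nat \<Rightarrow> (nat \<Rightarrow> real) \<Rightarrow> real" where
  "dev q e x = q - of_bool (circ_dist (x (fst e)) (x (snd e)) > 1 - q)"

lemma dev_edge: "dev q (edge u v) x = q - of_bool (circ_dist (x u) (x v) > 1 - q)"
  by (auto simp: dev_def edge_def min_def max_def circ_dist_commute)

lemma dev_abs_le: "0 \<le> q \<Longrightarrow> q \<le> 1 \<Longrightarrow> \<bar>dev q e x\<bar> \<le> 1"
  by (auto simp: dev_def)

lemma borel_measurable_dev [measurable]:
  assumes "fst e \<in> V" "snd e \<in> V"
  shows "dev q e \<in> borel_measurable (PiM V (\<lambda>_. circle))"
  unfolding dev_def[abs_def] using assms by measurable

lemma dev_upd: "v \<noteq> fst e \<Longrightarrow> v \<noteq> snd e \<Longrightarrow> dev q e (x(v := y)) = dev q e x"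
  by (simp add: dev_def)

lemma integral_of_bool_circ_dist:
  assumes "0 \<le> q" "q \<le> 1"
  shows "(\<integral>y. of_bool (circ_dist a y > 1 - q) \<partial>circle) = (q :: real)"
proof -
  have "(\<integral>y. of_bool (circ_dist a y > 1 - q) \<partial>circle) = (\<integral>y. indicat_real {y. circ_dist a y > 1 - q} y \<partial>circle)"
    by (intro Bochner_Integration.integral_cong) (auto simp: indicator_def)
  also have "\<dots> = measure circle {y. circ_dist a y > 1 - q}" by simp
  finally show ?thesis using measure_circ_dist_gt[of "1 - q"] assms by simp
qed

section \<open>Integration over independent points on the circle\<close>

lemma prob_space_PiM_circle: "prob_space (PiM V (\<lambda>_. circle))"
  by (intro prob_space_PiM prob_space_circle)

lemma integrable_PiM_circle_bounded:
  fixes f :: "(nat \<Rightarrow> real) \<Rightarrow> real"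
  assumes "f \<in> borel_measurable (PiM V (\<lambda>_. circle))" "\<And>x. \<bar>f x\<bar> \<le> C"
  shows "integrable (PiM V (\<lambda>_. circle)) f"
proof -
  interpret prob_space "PiM V (\<lambda>_. circle)" by (rule prob_space_PiM_circle)
  show ?thesis using assms by (intro integrable_const_bound[where B = C]) auto
qed

text \<open>Whatever the position of \<open>u\<close>, the edge fails with probability
  \<open>q\<close> over the position of \<open>v\<close>, and \<open>h\<close> ignores
  \<open>v\<close>. The factor is the mean of \<open>g\<close> over the two values of
  \<open>dev\<close>. Taking \<open>g\<close> as the identity gives cancellation at leaves, taking
  it as the absolute value gives the forest bound.\<close>

lemma integral_peel_vertex:
  fixes h :: "(nat \<Rightarrow> real) \<Rightarrow> real" and g :: "real \<Rightarrow> real"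
  assumes q: "0 \<le> q" "q \<le> 1" and V: "finite V" "u \<in> V" "v \<in> V" "u \<noteq> v"
    and h: "h \<in> borel_measurable (PiM V (\<lambda>_. circle))" "\<And>x. \<bar>h x\<bar> \<le> 1" "\<And>x y. h (x(v := y)) = h x"
  shows "(\<integral>x. h x * g (dev q (edge u v) x) \<partial>PiM V (\<lambda>_. circle)) =
    (q * g (q - 1) + (1 - q) * g q) * (\<integral>x. h x \<partial>PiM V (\<lambda>_. circle))"
proof -
  interpret circle: prob_space circle by (rule prob_space_circle)
  interpret product_prob_space "\<lambda>_::nat. circle" V by standard
  have fubini: "integral\<^sup>L (PiM V (\<lambda>_. circle)) f =
      (\<integral>x. (\<integral>y. f (x(v := y)) \<partial>circle) \<partial>PiM (V - {v}) (\<lambda>_. circle))"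
    if "integrable (PiM V (\<lambda>_. circle)) f" for f :: "(nat \<Rightarrow> real) \<Rightarrow> real"
    using product_integral_insert[of "V - {v}" v f] V that by (simp add: insert_absorb)
  define b where "b x = (of_bool (circ_dist (x u) (x v) > 1 - q) :: real)" for x :: "nat \<Rightarrow> real"
  have [measurable]: "b \<in> borel_measurable (PiM V (\<lambda>_. circle))"
    unfolding b_def[abs_def] using V by measurable
  \<comment> \<open>Since \<open>dev\<close> takes two values, any function of it is affine in the
    failure indicator \<open>b\<close>; only the product \<open>h * b\<close> then has to be
    integrated over \<open>v\<close> separately.\<close>
  have g: "g (dev q (edge u v) x) = g q + (g (q - 1) - g q) * b x" for x
    by (auto simp: dev_edge b_def)
  have int_h: "integrable (PiM V (\<lambda>_. circle)) h" using h by (intro integrable_PiM_circle_bounded)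
  have hb1: "\<bar>h x * b x\<bar> \<le> 1" for x using h(2)[of x] by (simp add: b_def)
  have int_hb: "integrable (PiM V (\<lambda>_. circle)) (\<lambda>x. h x * b x)"
    using h(1) hb1 by (intro integrable_PiM_circle_bounded borel_measurable_times) auto
  have "(\<integral>x. h x * b x \<partial>PiM V (\<lambda>_. circle)) =
      (\<integral>x. (\<integral>y. h (x(v := y)) * b (x(v := y)) \<partial>circle) \<partial>PiM (V - {v}) (\<lambda>_. circle))"
    using int_hb by (rule fubini)
  also have "\<dots> = (\<integral>x. h x * q \<partial>PiM (V - {v}) (\<lambda>_. circle))"
    using V integral_of_bool_circ_dist[OF q] by (simp add: h(3) b_def)
  also have "\<dots> = q * (\<integral>x. (\<integral>y. h (x(v := y)) \<partial>circle) \<partial>PiM (V - {v}) (\<lambda>_. circle))"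
    using circle.prob_space by (simp add: h(3))
  also have "(\<integral>x. (\<integral>y. h (x(v := y)) \<partial>circle) \<partial>PiM (V - {v}) (\<lambda>_. circle)) = (\<integral>x. h x \<partial>PiM V (\<lambda>_. circle))"
    using int_h by (rule fubini[symmetric])
  finally have hb: "(\<integral>x. h x * b x \<partial>PiM V (\<lambda>_. circle)) = q * (\<integral>x. h x \<partial>PiM V (\<lambda>_. circle))" .
  have "(\<integral>x. h x * g (dev q (edge u v) x) \<partial>PiM V (\<lambda>_. circle)) =
      (\<integral>x. g q * h x + (g (q - 1) - g q) * (h x * b x) \<partial>PiM V (\<lambda>_. circle))"
    by (simp add: g algebra_simps)
  also have "\<dots> = g q * (\<integral>x. h x \<partial>PiM V (\<lambda>_. circle)) +
      (g (q - 1) - g q) * (\<integral>x. h x * b x \<partial>PiM V (\<lambda>_. circle))"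
    using int_h int_hb by simp
  finally show ?thesis unfolding hb by (simp add: algebra_simps)
qed

lemma borel_measurable_prod_dev:
  assumes "verts T \<subseteq> V"
  shows "(\<lambda>x. \<Prod>e\<in>T. dev q e x) \<in> borel_measurable (PiM V (\<lambda>_. circle))"
    "(\<lambda>x. \<Prod>e\<in>T. \<bar>dev q e x\<bar>) \<in> borel_measurable (PiM V (\<lambda>_. circle))"
  using assms endpoints_in_verts[of _ T]
  by (auto intro!: borel_measurable_prod borel_measurable_abs borel_measurable_dev)

lemma prod_dev_abs_le:
  assumes "0 \<le> q" "q \<le> 1"
  shows "(\<Prod>e\<in>T. \<bar>dev q e x\<bar>) \<le> 1" "\<bar>\<Prod>e\<in>T. dev q e x\<bar> \<le> 1"
  using dev_abs_le[OF assms] by (auto simp: abs_prod intro!: prod_le_1)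

lemma integrable_prod_dev:
  assumes "0 \<le> q" "q \<le> 1" "verts T \<subseteq> V"
  shows "integrable (PiM V (\<lambda>_. circle)) (\<lambda>x. \<Prod>e\<in>T. dev q e x)"
    "integrable (PiM V (\<lambda>_. circle)) (\<lambda>x. \<Prod>e\<in>T. \<bar>dev q e x\<bar>)"
  using borel_measurable_prod_dev[OF assms(3)] prod_dev_abs_le[OF assms(1,2), of _ T]
  by (auto intro!: integrable_PiM_circle_bounded[where C = 1] simp: abs_prod)

lemma prod_dev_upd:
  assumes "v \<notin> verts T"
  shows "(\<Prod>e\<in>T. dev q e (x(v := y))) = (\<Prod>e\<in>T. dev q e x)"
    "(\<Prod>e\<in>T. \<bar>dev q e (x(v := y))\<bar>) = (\<Prod>e\<in>T. \<bar>dev q e x\<bar>)"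
proof -
  have "dev q e (x(v := y)) = dev q e x" if "e \<in> T" for e
    using assms that by (intro dev_upd) (auto simp: verts_def)
  then show "(\<Prod>e\<in>T. dev q e (x(v := y))) = (\<Prod>e\<in>T. dev q e x)"
    "(\<Prod>e\<in>T. \<bar>dev q e (x(v := y))\<bar>) = (\<Prod>e\<in>T. \<bar>dev q e x\<bar>)"
    by (auto intro!: prod.cong)
qed

text \<open>Removing the edges in reverse order of construction, each contributes the mean of its
  absolute deviation, \<open>2 * q * (1 - q)\<close>.\<close>

lemma integral_prod_dev_forest:
  assumes q: "0 \<le> q" "q \<le> 1" and V: "finite V"
  shows "forest F \<Longrightarrow> verts F \<subseteq> V \<Longrightarrow>
    (\<integral>x. (\<Prod>e\<in>F. \<bar>dev q e x\<bar>) \<partial>PiM V (\<lambda>_. circle)) \<le> (2 * q) ^ card F"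
proof (induction rule: forest.induct)
  case forest_empty
  interpret prob_space "PiM V (\<lambda>_. circle)" by (rule prob_space_PiM_circle)
  show ?case using prob_space by simp
next
  case (forest_insert F u v)
  have F: "verts F \<subseteq> V" "u \<in> V" "v \<in> V" using forest_insert.prems by auto
  have new: "edge u v \<notin> F"
    using forest_insert.hyps endpoints_in_verts[of "edge u v" F]
    by (auto simp: edge_def min_def max_def split: if_splits)
  have fin: "finite F" by (rule forest_finite) fact
  have "(\<integral>x. (\<Prod>e\<in>insert (edge u v) F. \<bar>dev q e x\<bar>) \<partial>PiM V (\<lambda>_. circle)) =
      (\<integral>x. (\<Prod>e\<in>F. \<bar>dev q e x\<bar>) * \<bar>dev q (edge u v) x\<bar> \<partial>PiM V (\<lambda>_. circle))"
    using fin new by (simp add: mult.commute)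
  also have "\<dots> = (q * \<bar>q - 1\<bar> + (1 - q) * \<bar>q\<bar>) * (\<integral>x. (\<Prod>e\<in>F. \<bar>dev q e x\<bar>) \<partial>PiM V (\<lambda>_. circle))"
    using q V F forest_insert.hyps borel_measurable_prod_dev(2)[OF F(1)] prod_dev_abs_le(1)[OF q]
    by (intro integral_peel_vertex) (auto simp: prod_dev_upd abs_prod)
  also have "\<dots> \<le> (2 * q) * (2 * q) ^ card F"
    using q forest_insert.IH[OF F(1)]
    by (intro mult_mono) (auto simp: algebra_simps intro!: integral_nonneg_AE prod_nonneg)
  finally show ?case using fin new by simp
qed

text \<open>Joint central moment of the edges of \<open>T\<close> in one coordinate. The coefficient
  \<beta>(T) of the overview is \<open>gamma n q T / (1 - q) ^ card T\<close>.\<close>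

definition gamma :: "nat \<Rightarrow> real \<Rightarrow> (nat \<times> nat) set \<Rightarrow> real" where
  "gamma n q T = (\<integral>x. (\<Prod>e\<in>T. dev q e x) \<partial>PiM {..<n} (\<lambda>_. circle))"

lemma abs_gamma_le_forest:
  assumes "0 \<le> q" "q \<le> 1" "T \<subseteq> all_edges n" "forest F" "F \<subseteq> T"
  shows "\<bar>gamma n q T\<bar> \<le> (2 * q) ^ card F"
proof -
  have T: "verts T \<subseteq> {..<n}" and fT: "finite T"
    using assms verts_all_edges finite_subset_all_edges by auto
  have F: "verts F \<subseteq> {..<n}" using T verts_mono[OF assms(5)] by auto
  have "\<bar>gamma n q T\<bar> \<le> (\<integral>x. \<bar>\<Prod>e\<in>T. dev q e x\<bar> \<partial>PiM {..<n} (\<lambda>_. circle))"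
    unfolding gamma_def by (rule integral_abs_bound)
  also have "\<dots> \<le> (\<integral>x. (\<Prod>e\<in>F. \<bar>dev q e x\<bar>) \<partial>PiM {..<n} (\<lambda>_. circle))"
  proof (rule integral_mono)
    fix x
    have "\<bar>\<Prod>e\<in>T. dev q e x\<bar> = (\<Prod>e\<in>T - F. \<bar>dev q e x\<bar>) * (\<Prod>e\<in>F. \<bar>dev q e x\<bar>)"
      unfolding abs_prod using assms(5) fT by (rule prod.subset_diff)
    also have "\<dots> \<le> 1 * (\<Prod>e\<in>F. \<bar>dev q e x\<bar>)"
      using prod_dev_abs_le(1)[OF assms(1,2)] by (intro mult_right_mono prod_nonneg) auto
    finally show "\<bar>\<Prod>e\<in>T. dev q e x\<bar> \<le> (\<Prod>e\<in>F. \<bar>dev q e x\<bar>)" by simp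
  qed (use assms T F in \<open>auto intro: integrable_prod_dev\<close>)
  also have "\<dots> \<le> (2 * q) ^ card F"
    using assms F by (intro integral_prod_dev_forest) auto
  finally show ?thesis .
qed

text \<open>A degree-one vertex \<open>v\<close> occurs in a single factor; integrating it out
  leaves the mean of a centred variable, which is zero.\<close>

lemma gamma_leaf:
  assumes "0 \<le> q" "q \<le> 1" "T \<subseteq> all_edges n" "\<not> leafless T"
  shows "gamma n q T = 0"
proof -
  obtain e v where e: "e \<in> T" "v \<in> {fst e, snd e}" "\<And>e'. e' \<in> T \<Longrightarrow> e' \<noteq> e \<Longrightarrow> v \<notin> {fst e', snd e'}"
    using assms(4) unfolding leafless_def by blast
  have T: "verts T \<subseteq> {..<n}" and fT: "finite T"
    using assms verts_all_edges finite_subset_all_edges by auto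
  have "e = edge (fst e) (snd e)" "fst e \<noteq> snd e" using edge_in_all_edges[of e n] e assms by auto
  then obtain u where u: "u \<noteq> v" "e = edge u v" "u = fst e \<or> u = snd e"
    using edge_commute[of "fst e" "snd e"] e(2) that[of "snd e"] that[of "fst e"] by auto
  have uv: "u < n" "v < n" using e(2) u(3) T endpoints_in_verts[OF e(1)] by blast+
  have v: "v \<notin> verts (T - {e})" using e(3) by (fastforce simp: verts_def)
  have T': "verts (T - {e}) \<subseteq> {..<n}" using T verts_mono[of "T - {e}" T] by auto
  have "gamma n q T = (\<integral>x. (\<Prod>e\<in>T - {e}. dev q e x) * dev q (edge u v) x \<partial>PiM {..<n} (\<lambda>_. circle))"
    unfolding gamma_def using fT e(1)
    by (intro Bochner_Integration.integral_cong refl) (simp add: prod.remove[of T e] mult.commute u(2)[symmetric])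
  also have "\<dots> = (q * (q - 1) + (1 - q) * q) * (\<integral>x. (\<Prod>e\<in>T - {e}. dev q e x) \<partial>PiM {..<n} (\<lambda>_. circle))"
    using assms u uv borel_measurable_prod_dev(1)[OF T'] prod_dev_abs_le(2)[OF assms(1,2)] v
    by (intro integral_peel_vertex[where g = "\<lambda>x. x"]) (auto simp: prod_dev_upd)
  finally show ?thesis by (simp add: algebra_simps)
qed

text \<open>Three pairwise almost antipodal points do not exist, so one of the three deviations equals
  \<open>q\<close> and the other two edges form a forest.\<close>

lemma abs_gamma_triangle:
  assumes q: "0 \<le> q" "q \<le> 1/3" and abc: "a \<noteq> b" "a \<noteq> c" "b \<noteq> c" "a < n" "b < n" "c < n"
  shows "\<bar>gamma n q {edge a b, edge b c, edge a c}\<bar> \<le> 12 * q ^ 3"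
proof -
  let ?P = "PiM {..<n} (\<lambda>_. circle)"
  let ?E1 = "{edge b c, edge a c}" and ?E2 = "{edge a b, edge a c}" and ?E3 = "{edge a b, edge b c}"
  let ?d = "\<lambda>F x. \<Prod>e\<in>F. \<bar>dev q e x\<bar>"
  have q1: "q \<le> 1" using q by simp
  have ne: "edge a b \<noteq> edge b c" "edge a b \<noteq> edge a c" "edge b c \<noteq> edge a c"
    using abc by (auto simp: edge_eq_iff)
  have f: "forest ?E1" "forest ?E2" "forest ?E3"
    using forest_two_edge_path[of a c b] forest_two_edge_path[of b a c] forest_two_edge_path[of a b c] abc
    by (auto simp: edge_commute insert_commute)
  have v: "verts ?E1 \<subseteq> {..<n}" "verts ?E2 \<subseteq> {..<n}" "verts ?E3 \<subseteq> {..<n}"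
    using abc by auto
  have int: "integrable ?P (?d ?E1)" "integrable ?P (?d ?E2)" "integrable ?P (?d ?E3)"
    using integrable_prod_dev(2)[OF q(1) q1] v by auto
  have le: "(\<integral>x. ?d ?E1 x \<partial>?P) \<le> 4 * q\<^sup>2" "(\<integral>x. ?d ?E2 x \<partial>?P) \<le> 4 * q\<^sup>2" "(\<integral>x. ?d ?E3 x \<partial>?P) \<le> 4 * q\<^sup>2"
    using integral_prod_dev_forest[OF q(1) q1 _ f(1) v(1)] integral_prod_dev_forest[OF q(1) q1 _ f(2) v(2)]
      integral_prod_dev_forest[OF q(1) q1 _ f(3) v(3)] ne
    by (simp_all add: power2_eq_square)
  have "\<bar>gamma n q {edge a b, edge b c, edge a c}\<bar> \<le>
      (\<integral>x. \<bar>\<Prod>e\<in>{edge a b, edge b c, edge a c}. dev q e x\<bar> \<partial>?P)"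
    unfolding gamma_def by (rule integral_abs_bound)
  also have "\<dots> \<le> (\<integral>x. q * (?d ?E1 x + ?d ?E2 x + ?d ?E3 x) \<partial>?P)"
  proof (rule integral_mono)
    fix x
    let ?A = "\<bar>dev q (edge a b) x\<bar>" and ?B = "\<bar>dev q (edge b c) x\<bar>" and ?C = "\<bar>dev q (edge a c) x\<bar>"
    have pos: "0 \<le> q * (?B * ?C)" "0 \<le> q * (?A * ?C)" "0 \<le> q * (?A * ?B)" using q by auto
    \<comment> \<open>Failure of all three edges would make the distances sum to more than
      \<open>3 * (1 - q)\<close>, which is at least 2 for \<open>q \<le> 1/3\<close>.\<close>
    have "?A = q \<or> ?B = q \<or> ?C = q"
      using circ_dist_perimeter[of "x a" "x b" "x c"] q unfolding dev_edge by (auto simp: not_less)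
    then have "?A * ?B * ?C \<le> q * (?B * ?C) + q * (?A * ?C) + q * (?A * ?B)"
      using pos by (elim disjE) (simp_all add: mult_ac)
    then show "\<bar>\<Prod>e\<in>{edge a b, edge b c, edge a c}. dev q e x\<bar> \<le> q * (?d ?E1 x + ?d ?E2 x + ?d ?E3 x)"
      using ne by (simp add: abs_mult distrib_left mult.assoc)
  next
    show "integrable ?P (\<lambda>x. \<bar>\<Prod>e\<in>{edge a b, edge b c, edge a c}. dev q e x\<bar>)"
      using abc by (intro integrable_abs integrable_prod_dev(1)[OF q(1) q1]) auto
  next
    show "integrable ?P (\<lambda>x. q * (?d ?E1 x + ?d ?E2 x + ?d ?E3 x))"
      by (intro integrable_mult_right Bochner_Integration.integrable_add int)
  qed
  also have "\<dots> = q * ((\<integral>x. ?d ?E1 x \<partial>?P) + (\<integral>x. ?d ?E2 x \<partial>?P) + (\<integral>x. ?d ?E3 x \<partial>?P))"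
    by (simp only: integral_mult_right_zero Bochner_Integration.integral_add[OF Bochner_Integration.integrable_add[OF int(1,2)] int(3)]
      Bochner_Integration.integral_add[OF int(1,2)])
  also have "\<dots> \<le> q * (12 * q\<^sup>2)" using le q by (intro mult_left_mono) auto
  finally show ?thesis by (simp add: power2_eq_square power3_eq_cube)
qed

text \<open>Powers of \<open>sqrt q\<close> keep the exponent v/2 + 1 integral. The surplus
  \<open>+ 2\<close> is one factor \<open>q\<close> beyond the vertex count; it pays for the d
  coordinates, as \<open>d * q\<close> is only logarithmic. For the triangle v + 2 = 5, whereas a
  spanning path alone would give exponent 4.\<close>

lemma abs_gamma_leafless:
  assumes q: "0 \<le> q" "q \<le> 1/3" and T: "T \<subseteq> all_edges n" "leafless T" "T \<noteq> {}"
  shows "\<bar>gamma n q T\<bar> \<le> 4 ^ card T * sqrt q ^ (card (verts T) + 2)"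
proof (cases "\<exists>a b c. a \<noteq> b \<and> a \<noteq> c \<and> b \<noteq> c \<and> T = {edge a b, edge b c, edge a c}")
  case True
  then obtain a b c where abc: "a \<noteq> b" "a \<noteq> c" "b \<noteq> c" "T = {edge a b, edge b c, edge a c}" by blast
  have v: "verts T = {a, b, c}" unfolding abc(4) by (auto simp: insert_commute)
  have "a < n" "b < n" "c < n" using verts_all_edges[OF T(1)] v by auto
  then have "\<bar>gamma n q T\<bar> \<le> 12 * q ^ 3"
    unfolding abc(4) using q abc by (intro abs_gamma_triangle) auto
  also have "q ^ 3 = sqrt q ^ 6"
    using q power_mult[of "sqrt q" 2 3] by simp
  also have "sqrt q ^ 6 \<le> sqrt q ^ 5" using q by (intro power_decreasing) auto
  also have "12 * sqrt q ^ 5 \<le> 4 ^ 3 * sqrt q ^ 5" using q by (intro mult_right_mono) auto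
  also have "card T = 3" using abc by (auto simp: edge_eq_iff)
  moreover have "card (verts T) = 3" using v abc by auto
  ultimately show ?thesis by simp
next
  case False
  have fT: "finite T" using T(1) by (rule finite_subset_all_edges)
  have "\<exists>u v. u \<noteq> v \<and> e = edge u v" if "e \<in> T" for e
    using edge_in_all_edges[of e n] that T(1) by blast
  then obtain F where F: "forest F" "F \<subseteq> T" "card (verts T) + 2 \<le> 2 * card F"
    using leafless_has_large_forest[OF fT _ T(2,3)] False by blast
  have "\<bar>gamma n q T\<bar> \<le> (2 * q) ^ card F"
    using q T F by (intro abs_gamma_le_forest) auto
  also have "\<dots> = 2 ^ card F * sqrt q ^ (2 * card F)"
    using q by (simp add: power_mult_distrib power_mult)
  also have "\<dots> \<le> 4 ^ card T * sqrt q ^ (card (verts T) + 2)"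
  proof (rule mult_mono)
    have "(2::real) ^ card F \<le> 2 ^ card T"
      using F(2) fT by (intro power_increasing card_mono) auto
    also have "\<dots> \<le> 4 ^ card T" by (intro power_mono) auto
    finally show "(2::real) ^ card F \<le> 4 ^ card T" .
    show "sqrt q ^ (2 * card F) \<le> sqrt q ^ (card (verts T) + 2)"
      using q F(3) by (intro power_decreasing) auto
  qed (use q in auto)
  finally show ?thesis .
qed

section \<open>The random geometric graph\<close>

text \<open>Integrating out one vertex at a time, in all coordinates at once, avoids exchanging the two
  product measures.\<close>

lemma nn_integral_latent_coordinates:
  fixes g :: "nat \<Rightarrow> (nat \<Rightarrow> real) \<Rightarrow> ennreal"
  assumes "finite I" "\<And>k. k < d \<Longrightarrow> g k \<in> borel_measurable (PiM I (\<lambda>_. circle))"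
  shows "(\<integral>\<^sup>+X. (\<Prod>k<d. g k (\<lambda>i\<in>I. X i k)) \<partial>PiM I (\<lambda>_::nat. torus_unif d)) =
    (\<Prod>k<d. \<integral>\<^sup>+x. g k x \<partial>PiM I (\<lambda>_. circle))"
  using assms
proof (induction I arbitrary: g rule: finite_induct)
  case empty
  interpret circle: prob_space circle by (rule prob_space_circle)
  interpret torus: prob_space "torus_unif d"
    unfolding torus_unif_def by (rule prob_space_PiM_circle)
  interpret C: product_sigma_finite "\<lambda>_::nat. circle" ..
  interpret T: product_sigma_finite "\<lambda>_::nat. torus_unif d" ..
  show ?case
    unfolding PiM_empty by (simp add: nn_integral_count_space_finite restrict_def)
next
  case (insert i I)
  interpret circle: prob_space circle by (rule prob_space_circle)
  interpret torus: prob_space "torus_unif d"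
    unfolding torus_unif_def by (rule prob_space_PiM_circle)
  interpret C: product_sigma_finite "\<lambda>_::nat. circle" ..
  interpret T: product_sigma_finite "\<lambda>_::nat. torus_unif d" ..
  have coord: "(\<lambda>X. \<lambda>j\<in>J. X j k) \<in> measurable (PiM J (\<lambda>_. torus_unif d)) (PiM J (\<lambda>_. circle))"
    if "k < d" for J :: "nat set" and k
  proof (rule measurable_restrict)
    fix j assume "j \<in> J"
    have "(\<lambda>y. y k) \<in> measurable (torus_unif d) circle"
      unfolding torus_unif_def using that by (intro measurable_component_singleton) auto
    with \<open>j \<in> J\<close> show "(\<lambda>X. X j k) \<in> measurable (PiM J (\<lambda>_. torus_unif d)) circle"
      by (intro measurable_compose[OF measurable_component_singleton])
  qed
  have upd: "(\<lambda>z. (fst z)(i := snd z)) \<in>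
      measurable (PiM I (\<lambda>_. circle) \<Otimes>\<^sub>M circle) (PiM (insert i I) (\<lambda>_. circle))"
    by (rule measurable_fun_upd[where J = I]) auto
  have g_upd: "(\<lambda>z. g k ((fst z)(i := snd z))) \<in> borel_measurable (PiM I (\<lambda>_. circle) \<Otimes>\<^sub>M circle)"
    if "k < d" for k
    by (rule measurable_compose[OF upd insert.prems[OF that]])
  \<comment> \<open>In coordinate \<open>k\<close>, \<open>h k\<close> is \<open>g k\<close> with
    the position of the new vertex \<open>i\<close> averaged out, so the induction hypothesis
    applies to \<open>h\<close>.\<close>
  define h where "h k z = (\<integral>\<^sup>+t. g k (z(i := t)) \<partial>circle)" for k z
  have h: "h k \<in> borel_measurable (PiM I (\<lambda>_. circle))" if "k < d" for k
    unfolding h_def[abs_def]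
    using g_upd[OF that] by (intro circle.borel_measurable_nn_integral) (simp add: case_prod_unfold)
  have "(\<integral>\<^sup>+X. (\<Prod>k<d. g k (\<lambda>j\<in>insert i I. X j k)) \<partial>PiM (insert i I) (\<lambda>_. torus_unif d)) =
    (\<integral>\<^sup>+X. (\<integral>\<^sup>+y. (\<Prod>k<d. g k (\<lambda>j\<in>insert i I. (X(i := y)) j k)) \<partial>torus_unif d) \<partial>PiM I (\<lambda>_. torus_unif d))"
    using insert.hyps
    by (intro T.product_nn_integral_insert borel_measurable_prod_ennreal measurable_compose[OF coord insert.prems]) auto
  also have "\<dots> = (\<integral>\<^sup>+X. (\<Prod>k<d. h k (\<lambda>j\<in>I. X j k)) \<partial>PiM I (\<lambda>_. torus_unif d))"
  proof (rule nn_integral_cong)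
    fix X assume "X \<in> space (PiM I (\<lambda>_. torus_unif d))"
    have "(\<lambda>j\<in>insert i I. (X(i := y)) j k) = (\<lambda>j\<in>I. X j k)(i := y k)" for y k
      using insert.hyps by (auto simp: restrict_def fun_eq_iff)
    then have "(\<integral>\<^sup>+y. (\<Prod>k<d. g k (\<lambda>j\<in>insert i I. (X(i := y)) j k)) \<partial>torus_unif d) =
        (\<integral>\<^sup>+y. (\<Prod>k<d. g k ((\<lambda>j\<in>I. X j k)(i := y k))) \<partial>torus_unif d)" by simp
    \<comment> \<open>With the other vertices fixed, the coordinates of the new point are
      independent, so its integral factorises.\<close>
    also have "\<dots> = (\<Prod>k<d. h k (\<lambda>j\<in>I. X j k))"
      unfolding torus_unif_def h_def
    proof (rule C.product_nn_integral_prod)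
      fix k assume "k \<in> {..<d}"
      have "(\<lambda>t. ((\<lambda>j\<in>I. X j k), t)) \<in> measurable circle (PiM I (\<lambda>_. circle) \<Otimes>\<^sub>M circle)"
        by (intro measurable_Pair1') (auto simp: space_PiM)
      from measurable_compose[OF this g_upd[of k]] \<open>k \<in> {..<d}\<close>
      show "(\<lambda>t. g k ((\<lambda>j\<in>I. X j k)(i := t))) \<in> borel_measurable circle" by simp
    qed simp
    finally show "(\<integral>\<^sup>+y. (\<Prod>k<d. g k (\<lambda>j\<in>insert i I. (X(i := y)) j k)) \<partial>torus_unif d) =
      (\<Prod>k<d. h k (\<lambda>j\<in>I. X j k))" .
  qed
  also have "\<dots> = (\<Prod>k<d. \<integral>\<^sup>+x. h k x \<partial>PiM I (\<lambda>_. circle))"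
    by (rule insert.IH[OF h])
  also have "\<dots> = (\<Prod>k<d. \<integral>\<^sup>+x. g k x \<partial>PiM (insert i I) (\<lambda>_. circle))"
    unfolding h_def using insert.hyps insert.prems
    by (intro prod.cong refl C.product_nn_integral_insert[symmetric]) auto
  finally show ?case .
qed

section \<open>The connection threshold in closed form\<close>

lemma linf_dist_le_iff:
  "d > 0 \<Longrightarrow> linf_dist d x y \<le> \<tau> \<longleftrightarrow> (\<forall>k<d. circ_dist (x k) (y k) \<le> \<tau>)"
  unfolding linf_dist_def by (subst Max_le_iff) auto

lemma prob_space_torus: "prob_space (torus_unif d)"
  unfolding torus_unif_def by (rule prob_space_PiM_circle)

lemma measurable_torus_component [measurable]:
  assumes "k < d"
  shows "(\<lambda>y. y k) \<in> borel_measurable (torus_unif d)"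
proof -
  have [measurable]: "k \<in> {..<d}" using assms by simp
  show ?thesis unfolding torus_unif_def by measurable
qed

text \<open>For fixed \<open>x\<close> the admissible \<open>y\<close> form a box of d arcs, each of
  measure \<open>\<tau>\<close> whatever its centre.\<close>

lemma measure_linf_dist_le:
  assumes "d > 0" "0 \<le> \<tau>" "\<tau> \<le> 1"
  shows "measure (torus_unif d \<Otimes>\<^sub>M torus_unif d)
    {z \<in> space (torus_unif d \<Otimes>\<^sub>M torus_unif d). linf_dist d (fst z) (snd z) \<le> \<tau>} = \<tau> ^ d"
proof -
  interpret circle: prob_space circle by (rule prob_space_circle)
  interpret torus: prob_space "torus_unif d" by (rule prob_space_torus)
  interpret C: product_sigma_finite "\<lambda>_::nat. circle" ..
  let ?A = "{z \<in> space (torus_unif d \<Otimes>\<^sub>M torus_unif d). \<forall>k\<in>{..<d}. circ_dist (fst z k) (snd z k) \<le> \<tau>}"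
  have A: "?A \<in> sets (torus_unif d \<Otimes>\<^sub>M torus_unif d)"
  proof (intro sets.sets_Collect_finite_All)
    fix k assume "k \<in> {..<d}"
    then have k: "k < d" by simp
    have [measurable]: "(\<lambda>z. fst z k) \<in> borel_measurable (torus_unif d \<Otimes>\<^sub>M torus_unif d)"
      "(\<lambda>z. snd z k) \<in> borel_measurable (torus_unif d \<Otimes>\<^sub>M torus_unif d)"
      using measurable_compose[OF measurable_fst measurable_torus_component[OF k]]
        measurable_compose[OF measurable_snd measurable_torus_component[OF k]] by auto
    show "{z \<in> space (torus_unif d \<Otimes>\<^sub>M torus_unif d). circ_dist (fst z k) (snd z k) \<le> \<tau>}
        \<in> sets (torus_unif d \<Otimes>\<^sub>M torus_unif d)"
      by measurable
  qed simp
  have slice: "emeasure (torus_unif d) (Pair x -` ?A) = ennreal (\<tau> ^ d)" if "x \<in> space (torus_unif d)" for x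
  proof -
    have space: "space (torus_unif d) = Pi\<^sub>E {..<d} (\<lambda>_. UNIV)"
      by (simp add: torus_unif_def space_PiM)
    have "Pair x -` ?A = {y \<in> space (torus_unif d). \<forall>k\<in>{..<d}. circ_dist (x k) (y k) \<le> \<tau>}"
      using that by (simp add: space_pair_measure vimage_def)
    also have "\<dots> = Pi\<^sub>E {..<d} (\<lambda>k. {t. circ_dist (x k) t \<le> \<tau>})"
      unfolding space PiE_iff set_eq_iff by blast
    finally have "Pair x -` ?A = Pi\<^sub>E {..<d} (\<lambda>k. {t. circ_dist (x k) t \<le> \<tau>})" .
    moreover have "emeasure (torus_unif d) (Pi\<^sub>E {..<d} (\<lambda>k. {t. circ_dist (x k) t \<le> \<tau>})) =
        (\<Prod>k<d. emeasure circle {t. circ_dist (x k) t \<le> \<tau>})"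
      unfolding torus_unif_def by (rule C.emeasure_PiM) auto
    moreover have "emeasure circle {t. circ_dist (x k) t \<le> \<tau>} = ennreal \<tau>" for k
      by (simp only: circle.emeasure_eq_measure measure_circ_dist_le[OF assms(2,3)])
    ultimately show ?thesis
      using assms by (simp only: prod_constant card_lessThan ennreal_power)
  qed
  have "emeasure (torus_unif d \<Otimes>\<^sub>M torus_unif d) ?A = (\<integral>\<^sup>+x. ennreal (\<tau> ^ d) \<partial>torus_unif d)"
    unfolding torus.emeasure_pair_measure_alt[OF A] by (intro nn_integral_cong slice)
  also have "\<dots> = ennreal (\<tau> ^ d)" by (simp add: torus.emeasure_space_1)
  finally have "measure (torus_unif d \<Otimes>\<^sub>M torus_unif d) ?A = \<tau> ^ d"
    using assms by (simp add: measure_def)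
  moreover have "{z \<in> space (torus_unif d \<Otimes>\<^sub>M torus_unif d). linf_dist d (fst z) (snd z) \<le> \<tau>} = ?A"
    using assms by (auto simp: linf_dist_le_iff)
  ultimately show ?thesis by simp
qed

text \<open>The definite description demands uniqueness among all reals. A negative threshold gives
  probability 0 and one above 1 gives probability 1, both excluded by 0 < p < 1; in between
  \<open>\<tau> ^ d\<close> is injective.\<close>

lemma tau_inf_eq_root:
  assumes "d > 0" "0 < p" "p < 1"
  shows "tau_inf d p = root d p"
  unfolding tau_inf_def
proof (rule the_equality)
  let ?M = "torus_unif d \<Otimes>\<^sub>M torus_unif d"
  have r: "0 \<le> root d p" "root d p \<le> 1" using assms by auto
  show "measure ?M {z \<in> space ?M. linf_dist d (fst z) (snd z) \<le> root d p} = p"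
    using measure_linf_dist_le[OF assms(1) r] assms by simp
  fix \<tau> assume \<tau>: "measure ?M {z \<in> space ?M. linf_dist d (fst z) (snd z) \<le> \<tau>} = p"
  have "0 \<le> \<tau>"
  proof (rule ccontr)
    assume "\<not> 0 \<le> \<tau>"
    then have "{z \<in> space ?M. linf_dist d (fst z) (snd z) \<le> \<tau>} = {}"
      using assms(1) circ_dist_bounds(1) by (fastforce simp: linf_dist_le_iff intro: order_trans)
    with \<tau> assms show False by simp
  qed
  moreover have "\<tau> \<le> 1"
  proof (rule ccontr)
    assume "\<not> \<tau> \<le> 1"
    then have "{z \<in> space ?M. linf_dist d (fst z) (snd z) \<le> \<tau>} =
        {z \<in> space ?M. linf_dist d (fst z) (snd z) \<le> 1}"
      using assms(1) circ_dist_bounds(2) by (fastforce simp: linf_dist_le_iff intro: order_trans)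
    with \<tau> measure_linf_dist_le[of d 1] assms show False by simp
  qed
  ultimately have "\<tau> ^ d = p" using \<tau> measure_linf_dist_le[of d \<tau>] assms by simp
  then show "\<tau> = root d p" using \<open>0 \<le> \<tau>\<close> assms by (simp add: real_root_power_cancel flip: \<open>\<tau> ^ d = p\<close>)
qed

section \<open>The law of the graph, its expectations and subgraph probabilities\<close>

definition rgg_prob :: "nat \<Rightarrow> nat \<Rightarrow> real \<Rightarrow> (nat \<times> nat) set \<Rightarrow> real" where
  "rgg_prob n d p G = measure (latent n d) {X \<in> space (latent n d). rgg_graph n d (tau_inf d p) X = G}"

lemma prob_space_latent: "prob_space (latent n d)"
  unfolding latent_def by (intro prob_space_PiM prob_space_torus)

lemma measurable_latent_component [measurable]:
  assumes "i < n" "k < d"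
  shows "(\<lambda>X. X i k) \<in> borel_measurable (latent n d)"
proof -
  have "(\<lambda>X. X i) \<in> measurable (latent n d) (torus_unif d)"
    unfolding latent_def using assms by (intro measurable_component_singleton) auto
  from measurable_compose[OF this measurable_torus_component[OF assms(2)]] show ?thesis .
qed

lemma sets_rgg_graph_eq:
  assumes "d > 0"
  shows "{X \<in> space (latent n d). rgg_graph n d \<tau> X = G} \<in> sets (latent n d)"
proof (cases "G \<subseteq> all_edges n")
  case True
  have "{X \<in> space (latent n d). rgg_graph n d \<tau> X = G} = {X \<in> space (latent n d). \<forall>e\<in>all_edges n.
      (\<forall>k\<in>{..<d}. circ_dist (X (fst e) k) (X (snd e) k) \<le> \<tau>) \<longleftrightarrow> e \<in> G}"
    using True assms by (auto simp: rgg_graph_def linf_dist_le_iff)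
  also have "\<dots> \<in> sets (latent n d)"
  proof (intro sets.sets_Collect_finite_All)
    fix e assume "e \<in> all_edges n"
    then have [measurable]: "fst e < n" "snd e < n" by (auto simp: all_edges_def)
    have "{X \<in> space (latent n d). \<forall>k\<in>{..<d}. circ_dist (X (fst e) k) (X (snd e) k) \<le> \<tau>} \<in> sets (latent n d)"
    proof (intro sets.sets_Collect_finite_All)
      fix k assume "k \<in> {..<d}"
      then have [measurable]: "k < d" by simp
      show "{X \<in> space (latent n d). circ_dist (X (fst e) k) (X (snd e) k) \<le> \<tau>} \<in> sets (latent n d)"
        by measurable
    qed simp
    then show "{X \<in> space (latent n d). (\<forall>k\<in>{..<d}. circ_dist (X (fst e) k) (X (snd e) k) \<le> \<tau>) \<longleftrightarrow> e \<in> G} \<in> sets (latent n d)"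
      by (cases "e \<in> G") (auto intro: sets.sets_Collect_neg)
  qed simp
  finally show ?thesis .
next
  case False
  then have "{X \<in> space (latent n d). rgg_graph n d \<tau> X = G} = {}" by (auto simp: rgg_graph_def)
  then show ?thesis by (simp only: sets.empty_sets)
qed

text \<open>The graph takes finitely many values on measurable events, so expectations of arbitrary
  \<open>F\<close> are finite sums and linearity holds without integrability conditions.\<close>

lemma E_rgg_eq_sum:
  assumes "d > 0"
  shows "E_rgg n d p F = (\<Sum>G\<in>Pow (all_edges n). rgg_prob n d p G * F G)"
proof -
  interpret prob_space "latent n d" by (rule prob_space_latent)
  let ?A = "\<lambda>G. {X \<in> space (latent n d). rgg_graph n d (tau_inf d p) X = G}"
  have "E_rgg n d p F = (\<integral>X. (\<Sum>G\<in>Pow (all_edges n). indicat_real (?A G) X * F G) \<partial>latent n d)"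
    unfolding E_rgg_def
  proof (rule Bochner_Integration.integral_cong[OF refl])
    fix X assume X: "X \<in> space (latent n d)"
    have "rgg_graph n d (tau_inf d p) X \<in> Pow (all_edges n)" by (auto simp: rgg_graph_def)
    moreover have "(\<Sum>G\<in>Pow (all_edges n). indicat_real (?A G) X * F G) =
        (\<Sum>G\<in>Pow (all_edges n). if rgg_graph n d (tau_inf d p) X = G then F G else 0)"
      using X by (intro sum.cong) (auto simp: indicator_def)
    ultimately show "F (rgg_graph n d (tau_inf d p) X) = (\<Sum>G\<in>Pow (all_edges n). indicat_real (?A G) X * F G)"
      by simp
  qed
  also have "\<dots> = (\<Sum>G\<in>Pow (all_edges n). \<integral>X. indicat_real (?A G) X * F G \<partial>latent n d)"
    using sets_rgg_graph_eq[OF assms]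
    by (intro Bochner_Integration.integral_sum integrable_mult_left integrable_real_indicator)
      (auto simp: emeasure_eq_measure)
  also have "\<dots> = (\<Sum>G\<in>Pow (all_edges n). rgg_prob n d p G * F G)"
    using sets_rgg_graph_eq[OF assms] by (intro sum.cong refl) (simp add: rgg_prob_def)
  finally show ?thesis .
qed

lemma E_rgg_sum:
  assumes "d > 0"
  shows "E_rgg n d p (\<lambda>G. \<Sum>i\<in>I. a i * F i G) = (\<Sum>i\<in>I. a i * E_rgg n d p (F i))"
  unfolding E_rgg_eq_sum[OF assms] sum_distrib_left
  by (subst sum.swap) (simp only: mult.left_commute)

lemma E_rgg_const: "E_rgg n d p (\<lambda>_. c) = c"
proof -
  interpret prob_space "latent n d" by (rule prob_space_latent)
  show ?thesis by (simp add: E_rgg_def prob_space)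
qed

lemma Var_rgg_nonneg:
  assumes "d > 0"
  shows "Var_rgg n d p F \<ge> 0"
proof -
  let ?m = "E_rgg n d p F"
  have "0 \<le> (\<Sum>G\<in>Pow (all_edges n). rgg_prob n d p G * (F G - ?m)\<^sup>2)"
    by (intro sum_nonneg) (simp add: rgg_prob_def)
  also have "\<dots> = (\<Sum>G\<in>Pow (all_edges n). rgg_prob n d p G * (F G)\<^sup>2) -
      2 * ?m * (\<Sum>G\<in>Pow (all_edges n). rgg_prob n d p G * F G) +
      ?m\<^sup>2 * (\<Sum>G\<in>Pow (all_edges n). rgg_prob n d p G * 1)"
    by (simp add: power2_diff algebra_simps sum.distrib sum_subtractf sum_distrib_left sum_distrib_right)
  also have "\<dots> = Var_rgg n d p F"
    unfolding E_rgg_eq_sum[OF assms, symmetric] E_rgg_const Var_rgg_def by (simp add: power2_eq_square)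
  finally show ?thesis .
qed

text \<open>All edges of \<open>S\<close> are present iff they are present in every coordinate, and
  coordinates are independent: the probability is a d-th power. Within one coordinate each presence
  indicator is \<open>dev + (1 - q)\<close>, and expanding the product over subsets produces the
  moments \<open>gamma\<close>.\<close>

lemma E_rgg_edges:
  assumes d: "d > 0" and p: "0 < p" "p < 1" and S: "S \<subseteq> all_edges n"
  defines "q \<equiv> 1 - root d p"
  shows "E_rgg n d p (\<lambda>G. \<Prod>e\<in>S. indicator G e) =
    (\<Sum>T\<in>Pow S. (1 - q) ^ (card S - card T) * gamma n q T) ^ d"
proof -
  let ?P = "PiM {..<n} (\<lambda>_. circle)"
  interpret P: prob_space ?P by (rule prob_space_PiM_circle)
  have q: "0 \<le> q" "q \<le> 1" using d p by (auto simp: q_def)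
  have fS: "finite S" using S by (rule finite_subset_all_edges)
  have vS: "verts S \<subseteq> {..<n}" using S by (rule verts_all_edges)
  have \<tau>: "tau_inf d p = 1 - q" using tau_inf_eq_root[OF d p] by (simp add: q_def)
  define g where "g x = (\<Prod>e\<in>S. dev q e x + (1 - q))" for x
  have g_bool: "g x = of_bool (\<forall>e\<in>S. circ_dist (x (fst e)) (x (snd e)) \<le> 1 - q)" for x
  proof -
    have "g x = (\<Prod>e\<in>S. of_bool (circ_dist (x (fst e)) (x (snd e)) \<le> 1 - q))"
      unfolding g_def by (intro prod.cong) (auto simp: dev_def)
    also have "\<dots> = of_bool (\<forall>e\<in>S. circ_dist (x (fst e)) (x (snd e)) \<le> 1 - q)"
      using fS by (induction S) auto
    finally show ?thesis .
  qed
  have g_meas: "g \<in> borel_measurable ?P"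
    unfolding g_def[abs_def]
  proof (intro borel_measurable_prod borel_measurable_add borel_measurable_const)
    fix e assume "e \<in> S"
    then have "fst e \<in> {..<n}" "snd e \<in> {..<n}" using endpoints_in_verts vS by blast+
    then show "dev q e \<in> borel_measurable ?P" by (rule borel_measurable_dev)
  qed
  have g_expand: "g x = (\<Sum>T\<in>Pow S. (1 - q) ^ (card S - card T) * (\<Prod>e\<in>T. dev q e x))" for x
    unfolding g_def prod_add[OF fS]
    by (intro sum.cong refl) (auto simp: card_Diff_subset finite_subset[OF _ fS])
  have "(\<integral>x. g x \<partial>?P) = (\<Sum>T\<in>Pow S. \<integral>x. (1 - q) ^ (card S - card T) * (\<Prod>e\<in>T. dev q e x) \<partial>?P)"
    unfolding g_expand
  proof (intro Bochner_Integration.integral_sum integrable_mult_right)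
    fix T assume "T \<in> Pow S"
    then have "verts T \<subseteq> {..<n}" using verts_mono[of T S] vS by auto
    then show "integrable ?P (\<lambda>x. \<Prod>e\<in>T. dev q e x)" by (rule integrable_prod_dev(1)[OF q])
  qed
  then have int_g: "(\<integral>x. g x \<partial>?P) = (\<Sum>T\<in>Pow S. (1 - q) ^ (card S - card T) * gamma n q T)"
    by (simp add: gamma_def)
  have nn_g: "(\<integral>\<^sup>+x. ennreal (g x) \<partial>?P) = ennreal (\<integral>x. g x \<partial>?P)"
  proof (rule nn_integral_eq_integral)
    show "integrable ?P g"
      by (rule integrable_PiM_circle_bounded[OF g_meas, of 1]) (simp add: g_bool)
  qed (simp add: g_bool)
  have int_nonneg: "0 \<le> (\<integral>x. g x \<partial>?P)" by (rule integral_nonneg_AE) (simp add: g_bool)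
  have graph: "ennreal (\<Prod>e\<in>S. indicator (rgg_graph n d (1 - q) X) e) =
      (\<Prod>k<d. ennreal (g (\<lambda>i\<in>{..<n}. X i k)))" for X
  proof -
    have lt: "fst e < n" "snd e < n" if "e \<in> S" for e using that S by (auto simp: all_edges_def)
    have "(\<Prod>e\<in>S. indicat_real (rgg_graph n d (1 - q) X) e) = of_bool (\<forall>e\<in>S. e \<in> rgg_graph n d (1 - q) X)"
      using fS by (induction S) auto
    also have "(\<forall>e\<in>S. e \<in> rgg_graph n d (1 - q) X) \<longleftrightarrow>
        (\<forall>k\<in>{..<d}. \<forall>e\<in>S. circ_dist (X (fst e) k) (X (snd e) k) \<le> 1 - q)"
      using S d by (auto simp: rgg_graph_def linf_dist_le_iff)
    also have "of_bool \<dots> = (\<Prod>k<d. g (\<lambda>i\<in>{..<n}. X i k))"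
    proof -
      have "(\<Prod>k\<in>K. of_bool (Q k)) = (of_bool (\<forall>k\<in>K. Q k) :: real)" if "finite K" for K :: "nat set" and Q
        using that by induction auto
      then show ?thesis unfolding g_bool using lt by simp
    qed
    finally show ?thesis by (simp add: prod_ennreal g_bool)
  qed
  have "(\<integral>\<^sup>+X. ennreal (\<Prod>e\<in>S. indicator (rgg_graph n d (1 - q) X) e) \<partial>latent n d) =
      (\<Prod>k<d. \<integral>\<^sup>+x. ennreal (g x) \<partial>?P)"
    unfolding graph latent_def
    by (rule nn_integral_latent_coordinates) (use g_meas in auto)
  also have "\<dots> = ennreal ((\<integral>x. g x \<partial>?P) ^ d)"
    unfolding nn_g using int_nonneg by (simp add: ennreal_power)
  finally have nn: "(\<integral>\<^sup>+X. ennreal (\<Prod>e\<in>S. indicator (rgg_graph n d (1 - q) X) e) \<partial>latent n d) =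
      ennreal ((\<integral>x. g x \<partial>?P) ^ d)" .
  have "E_rgg n d p (\<lambda>G. \<Prod>e\<in>S. indicator G e) = (\<integral>x. g x \<partial>?P) ^ d"
  proof -
    have "(\<lambda>X. \<Prod>e\<in>S. indicat_real (rgg_graph n d (1 - q) X) e) \<in> borel_measurable (latent n d)"
    proof (intro borel_measurable_prod)
      fix e assume e: "e \<in> S"
      \<comment> \<open>Writing the indicator as a finite combination of the events that fix the
        whole graph reduces measurability to \<open>sets_rgg_graph_eq\<close>.\<close>
      have sum: "indicat_real (rgg_graph n d (1 - q) X) e =
          (\<Sum>G\<in>Pow (all_edges n). indicat_real {X \<in> space (latent n d). rgg_graph n d (1 - q) X = G} X * indicat_real G e)"
        if X: "X \<in> space (latent n d)" for X
      proof -
        have "(\<Sum>G\<in>Pow (all_edges n). indicat_real {X \<in> space (latent n d). rgg_graph n d (1 - q) X = G} X * indicat_real G e) =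
            (\<Sum>G\<in>Pow (all_edges n). if rgg_graph n d (1 - q) X = G then indicat_real G e else 0)"
          using X by (intro sum.cong) (auto simp: indicator_def)
        then show ?thesis by (simp add: rgg_graph_def)
      qed
      have "(\<lambda>X. \<Sum>G\<in>Pow (all_edges n). indicat_real {X \<in> space (latent n d). rgg_graph n d (1 - q) X = G} X
          * indicat_real G e) \<in> borel_measurable (latent n d)"
        by (intro borel_measurable_sum borel_measurable_times borel_measurable_indicator
            borel_measurable_const sets_rgg_graph_eq[OF d])
      then show "(\<lambda>X. indicat_real (rgg_graph n d (1 - q) X) e) \<in> borel_measurable (latent n d)"
        by (rule measurable_cong[THEN iffD2, rotated]) (rule sum)
    qed
    then show ?thesis
      unfolding E_rgg_def \<tau> using nn int_nonneg
      by (subst integral_eq_nn_integral) (auto intro!: prod_nonneg)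
  qed
  then show ?thesis unfolding int_g .
qed

text \<open>Because \<open>(1 - q) ^ d = p\<close>, pulling \<open>(1 - q) ^ card S\<close> out of
  the d-th power yields \<open>p ^ card S\<close>. It combines with
  \<open>p ^ (card H - card S)\<close> from the expansion around \<open>p\<close> into a prefactor
  independent of \<open>S\<close>.\<close>

lemma E_rgg_centred:
  assumes d: "d > 0" and p: "0 < p" "p < 1" and H: "H \<subseteq> all_edges n"
  defines "q \<equiv> 1 - root d p"
  shows "E_rgg n d p (\<lambda>G. \<Prod>e\<in>H. indicator G e - p) =
    p ^ card H * (\<Sum>S\<in>Pow H. (-1) ^ (card H - card S) * (\<Sum>T\<in>Pow S. gamma n q T / (1 - q) ^ card T) ^ d)"
proof -
  have fH: "finite H" using H by (rule finite_subset_all_edges)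
  have q1: "1 - q > 0" and pd: "(1 - q) ^ d = p" using d p by (auto simp: q_def)
  have "(\<Prod>e\<in>H. indicator G e - p) =
      (\<Sum>S\<in>Pow H. ((-1) ^ (card H - card S) * p ^ (card H - card S)) * (\<Prod>e\<in>S. indicator G e))" for G
    unfolding prod_diff_conv_sum'[OF fH]
    by (intro sum.cong refl) (auto simp: card_Diff_subset finite_subset[OF _ fH])
  then have "E_rgg n d p (\<lambda>G. \<Prod>e\<in>H. indicator G e - p) =
      (\<Sum>S\<in>Pow H. ((-1) ^ (card H - card S) * p ^ (card H - card S)) * E_rgg n d p (\<lambda>G. \<Prod>e\<in>S. indicator G e))"
    using E_rgg_sum[OF d] by simp
  also have "\<dots> = (\<Sum>S\<in>Pow H. p ^ card H * ((-1) ^ (card H - card S) *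
      (\<Sum>T\<in>Pow S. gamma n q T / (1 - q) ^ card T) ^ d))"
  proof (rule sum.cong[OF refl])
    fix S assume S: "S \<in> Pow H"
    have fS: "finite S" using S fH finite_subset by auto
    have "(\<Sum>T\<in>Pow S. (1 - q) ^ (card S - card T) * gamma n q T) =
        (1 - q) ^ card S * (\<Sum>T\<in>Pow S. gamma n q T / (1 - q) ^ card T)"
      unfolding sum_distrib_left
      using q1 fS by (intro sum.cong refl) (auto simp: power_diff card_mono)
    then have "E_rgg n d p (\<lambda>G. \<Prod>e\<in>S. indicator G e) =
        ((1 - q) ^ card S) ^ d * (\<Sum>T\<in>Pow S. gamma n q T / (1 - q) ^ card T) ^ d"
      using E_rgg_edges[OF d p, of S n] S H by (simp add: q_def power_mult_distrib)
    also have "((1 - q) ^ card S) ^ d = p ^ card S"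
      unfolding pd[symmetric] by (simp only: power_mult[symmetric] mult.commute)
    finally have "E_rgg n d p (\<lambda>G. \<Prod>e\<in>S. indicator G e) =
        p ^ card S * (\<Sum>T\<in>Pow S. gamma n q T / (1 - q) ^ card T) ^ d" .
    moreover have "p ^ (card H - card S) * p ^ card S = p ^ card H"
      using S fH by (simp add: power_add[symmetric] card_mono)
    ultimately show "(-1) ^ (card H - card S) * p ^ (card H - card S) * E_rgg n d p (\<lambda>G. \<Prod>e\<in>S. indicator G e) =
      p ^ card H * ((-1) ^ (card H - card S) * (\<Sum>T\<in>Pow S. gamma n q T / (1 - q) ^ card T) ^ d)"
      by (simp add: mult_ac)
  qed
  finally show ?thesis by (simp add: sum_distrib_left)
qed

section \<open>The low-degree advantage\<close>

text \<open>Independence of the edges in G(n,p), as an expansion of a product of two-term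
  sums.\<close>

lemma E_gnp_prod:
  "E_gnp n p (\<lambda>G. \<Prod>e\<in>all_edges n. if e \<in> G then f e else g e) =
    (\<Prod>e\<in>all_edges n. p * f e + (1 - p) * g e)"
proof -
  let ?A = "all_edges n"
  have "(\<Prod>e\<in>?A. p * f e + (1 - p) * g e) =
      (\<Sum>G\<in>Pow ?A. (\<Prod>e\<in>G. p * f e) * (\<Prod>e\<in>?A - G. (1 - p) * g e))"
    by (rule prod_add) simp
  also have "\<dots> = (\<Sum>G\<in>Pow ?A. p ^ card G * (1 - p) ^ (card ?A - card G) *
      (\<Prod>e\<in>?A. if e \<in> G then f e else g e))"
  proof (rule sum.cong[OF refl])
    fix G assume G: "G \<in> Pow ?A"
    then have "finite G" using finite_subset_all_edges by auto
    have "(\<Prod>e\<in>?A. if e \<in> G then f e else g e) =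
        (\<Prod>e\<in>?A - G. if e \<in> G then f e else g e) * (\<Prod>e\<in>G. if e \<in> G then f e else g e)"
      using G by (intro prod.subset_diff) auto
    also have "\<dots> = (\<Prod>e\<in>?A - G. g e) * (\<Prod>e\<in>G. f e)"
      by (intro arg_cong2[where f = "(*)"] prod.cong) auto
    finally show "(\<Prod>e\<in>G. p * f e) * (\<Prod>e\<in>?A - G. (1 - p) * g e) =
        p ^ card G * (1 - p) ^ (card ?A - card G) * (\<Prod>e\<in>?A. if e \<in> G then f e else g e)"
      using G \<open>finite G\<close> by (simp add: prod.distrib card_Diff_subset mult_ac)
  qed
  finally show ?thesis by (simp add: E_gnp_def)
qed

lemma E_gnp_sum: "E_gnp n p (\<lambda>G. \<Sum>i\<in>I. a i * F i G) = (\<Sum>i\<in>I. a i * E_gnp n p (F i))"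
  unfolding E_gnp_def sum_distrib_left
  by (subst sum.swap) (simp only: mult.left_commute mult.assoc)

section \<open>The Fourier basis of G(n,p) and the Cauchy-Schwarz argument\<close>

definition centred :: "real \<Rightarrow> (nat \<times> nat) set \<Rightarrow> (nat \<times> nat) set \<Rightarrow> real" where
  "centred p T G = (\<Prod>e\<in>T. indicator G e - p)"

text \<open>Orthogonality: an edge lying in exactly one of the two sets contributes its mean, which
  is zero.\<close>

lemma E_gnp_centred_mult:
  assumes "S \<subseteq> all_edges n" "T \<subseteq> all_edges n"
  shows "E_gnp n p (\<lambda>G. centred p S G * centred p T G) = (if S = T then (p * (1 - p)) ^ card S else 0)"
proof -
  let ?A = "all_edges n"
  have extend: "centred p U G = (\<Prod>e\<in>?A. if e \<in> U then indicator G e - p else 1)" if "U \<subseteq> ?A" for U G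
    unfolding centred_def using that by (intro prod.mono_neutral_cong_left) auto
  let ?f = "\<lambda>e. (if e \<in> S then 1 - p else 1) * (if e \<in> T then 1 - p else 1)"
  let ?g = "\<lambda>e. (if e \<in> S then - p else 1) * (if e \<in> T then - p else 1)"
  have "(\<lambda>G. centred p S G * centred p T G) = (\<lambda>G. \<Prod>e\<in>?A. if e \<in> G then ?f e else ?g e)"
    unfolding extend[OF assms(1)] extend[OF assms(2)] prod.distrib[symmetric]
    by (intro ext prod.cong) auto
  then have "E_gnp n p (\<lambda>G. centred p S G * centred p T G) = (\<Prod>e\<in>?A. p * ?f e + (1 - p) * ?g e)"
    by (simp only: E_gnp_prod)
  also have "\<dots> = (if S = T then (p * (1 - p)) ^ card S else 0)"
  proof (cases "S = T")
    case True
    have "(\<Prod>e\<in>?A. p * ?f e + (1 - p) * ?g e) = (\<Prod>e\<in>S. p * (1 - p))"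
      using assms True by (intro prod.mono_neutral_cong_right) (auto simp: algebra_simps power2_eq_square)
    then show ?thesis using True by simp
  next
    case False
    then obtain e where e: "e \<in> ?A" "(e \<in> S) \<noteq> (e \<in> T)" using assms by blast
    then have "p * ?f e + (1 - p) * ?g e = 0" by (auto simp: algebra_simps)
    with e(1) have "(\<Prod>e\<in>?A. p * ?f e + (1 - p) * ?g e) = 0"
      by (intro prod_zero bexI[of _ e]) auto
    then show ?thesis using False by simp
  qed
  finally show ?thesis .
qed

text \<open>Substituting indicator = (indicator - p) + p in a monomial \<open>S\<close> produces
  only subsets of \<open>S\<close>, so the degree bound survives the change of basis.\<close>

lemma edge_poly_centred:
  "\<exists>a. \<forall>G. edge_poly n D c G = (\<Sum>T | T \<subseteq> all_edges n \<and> real (card T) \<le> D. a T * centred p T G)"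
proof -
  let ?\<S> = "{S. S \<subseteq> all_edges n \<and> real (card S) \<le> D}"
  have fin: "finite ?\<S>" by (rule finite_subset[of _ "Pow (all_edges n)"]) auto
  define a where "a T = (\<Sum>S\<in>?\<S>. if T \<subseteq> S then c S * p ^ (card S - card T) else 0)" for T
  have "edge_poly n D c G = (\<Sum>T\<in>?\<S>. a T * centred p T G)" for G
  proof -
    have "edge_poly n D c G = (\<Sum>S\<in>?\<S>. \<Sum>T\<in>?\<S>. if T \<subseteq> S then c S * p ^ (card S - card T) * centred p T G else 0)"
      unfolding edge_poly_def
    proof (rule sum.cong[OF refl])
      fix S assume S: "S \<in> ?\<S>"
      have fS: "finite S" using S finite_subset_all_edges by auto
      have sub: "Pow S \<subseteq> ?\<S>"
      proof
        fix T assume "T \<in> Pow S"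
        then have "card T \<le> card S" using fS by (auto intro: card_mono)
        with S \<open>T \<in> Pow S\<close> show "T \<in> ?\<S>" by auto
      qed
      have "(\<Prod>e\<in>S. indicator G e) = (\<Prod>e\<in>S. (indicator G e - p) + p)" by simp
      also have "\<dots> = (\<Sum>T\<in>Pow S. centred p T G * p ^ (card S - card T))"
        unfolding prod_add[OF fS] centred_def
        by (intro sum.cong refl) (auto simp: card_Diff_subset finite_subset[OF _ fS])
      finally have "c S * (\<Prod>e\<in>S. indicator G e) =
          (\<Sum>T\<in>Pow S. c S * p ^ (card S - card T) * centred p T G)"
        by (simp add: sum_distrib_left mult_ac)
      also have "\<dots> = (\<Sum>T\<in>?\<S>. if T \<subseteq> S then c S * p ^ (card S - card T) * centred p T G else 0)"
        using fin sub by (intro sum.mono_neutral_cong_left) auto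
      finally show "c S * (\<Prod>e\<in>S. indicator G e) =
        (\<Sum>T\<in>?\<S>. if T \<subseteq> S then c S * p ^ (card S - card T) * centred p T G else 0)" .
    qed
    also have "\<dots> = (\<Sum>T\<in>?\<S>. \<Sum>S\<in>?\<S>. if T \<subseteq> S then c S * p ^ (card S - card T) * centred p T G else 0)"
      by (rule sum.swap)
    also have "\<dots> = (\<Sum>T\<in>?\<S>. a T * centred p T G)"
      unfolding a_def sum_distrib_right by (intro sum.cong refl) auto
    finally show ?thesis .
  qed
  then show ?thesis by blast
qed

text \<open>In the centred basis the two means share the constant term, and \<open>Var_gnp\<close>
  is the weighted sum of squares of the other coefficients. Cauchy-Schwarz separates these
  coefficients from the expectations under the geometric graph; adding the nonnegative
  \<open>Var_rgg\<close> only enlarges the bound.\<close>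

lemma low_degree_advantage:
  assumes d: "d > 0" and p: "0 < p" "p < 1" and D: "D \<ge> 0" and "\<eta> \<ge> 0"
    and adv: "(\<Sum>T | T \<subseteq> all_edges n \<and> real (card T) \<le> D \<and> T \<noteq> {}.
      (E_rgg n d p (centred p T))\<^sup>2 / (p * (1 - p)) ^ card T) \<le> \<eta>\<^sup>2"
  shows "\<bar>E_rgg n d p (edge_poly n D c) - E_gnp n p (edge_poly n D c)\<bar>
    \<le> \<eta> * sqrt (Var_gnp n p (edge_poly n D c) + Var_rgg n d p (edge_poly n D c))"
proof -
  let ?\<S> = "{S. S \<subseteq> all_edges n \<and> real (card S) \<le> D}"
  let ?\<T> = "{S. S \<subseteq> all_edges n \<and> real (card S) \<le> D \<and> S \<noteq> {}}"
  have fin: "finite ?\<S>" by (rule finite_subset[of _ "Pow (all_edges n)"]) auto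
  have \<T>: "?\<S> - {{}} = ?\<T>" and e: "{} \<in> ?\<S>" using D by auto
  obtain a where a: "\<And>G. edge_poly n D c G = (\<Sum>T\<in>?\<S>. a T * centred p T G)"
    using edge_poly_centred[of n D c p] by auto
  define \<sigma> where "\<sigma> = p * (1 - p)"
  have \<sigma>: "\<sigma> > 0" using p by (simp add: \<sigma>_def)
  have poly: "edge_poly n D c = (\<lambda>G. \<Sum>T\<in>?\<S>. a T * centred p T G)" by (rule ext) (rule a)
  have gnp1: "E_gnp n p (centred p T) = (if T = {} then 1 else 0)" if "T \<in> ?\<S>" for T
    using E_gnp_centred_mult[of "{}" n T p] that by (auto simp: centred_def[abs_def])
  have "E_gnp n p (edge_poly n D c) = (\<Sum>T\<in>?\<S>. a T * (if T = {} then 1 else 0))"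
    unfolding poly E_gnp_sum using gnp1 by (intro sum.cong) auto
  also have "\<dots> = a {}" using fin e by (simp add: sum.delta if_distrib[of "(*) _"] cong: if_cong)
  finally have Eg: "E_gnp n p (edge_poly n D c) = a {}" .
  have "(edge_poly n D c G)\<^sup>2 = (\<Sum>z\<in>?\<S> \<times> ?\<S>. (a (fst z) * a (snd z)) * (centred p (fst z) G * centred p (snd z) G))" for G
    unfolding a power2_eq_square sum_product sum.cartesian_product
    by (intro sum.cong) (auto simp: mult_ac)
  then have "E_gnp n p (\<lambda>G. (edge_poly n D c G)\<^sup>2) =
      (\<Sum>z\<in>?\<S> \<times> ?\<S>. (a (fst z) * a (snd z)) * E_gnp n p (\<lambda>G. centred p (fst z) G * centred p (snd z) G))"
    by (simp only: E_gnp_sum)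
  also have "\<dots> = (\<Sum>S\<in>?\<S>. \<Sum>T\<in>?\<S>. (a S * a T) * (if S = T then \<sigma> ^ card S else 0))"
    unfolding sum.cartesian_product using E_gnp_centred_mult[of _ n _ p]
    by (intro sum.cong) (auto simp: \<sigma>_def)
  also have "\<dots> = (\<Sum>S\<in>?\<S>. (a S)\<^sup>2 * \<sigma> ^ card S)"
    using fin by (intro sum.cong refl) (simp add: if_distrib[of "(*) _"] power2_eq_square cong: if_cong)
  also have "\<dots> = (a {})\<^sup>2 + (\<Sum>S\<in>?\<T>. (a S)\<^sup>2 * \<sigma> ^ card S)"
    using fin e unfolding \<T>[symmetric] by (subst sum.remove[of _ "{}"]) auto
  finally have V: "Var_gnp n p (edge_poly n D c) = (\<Sum>S\<in>?\<T>. (a S)\<^sup>2 * \<sigma> ^ card S)"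
    by (simp add: Var_gnp_def Eg)
  have "E_rgg n d p (edge_poly n D c) = (\<Sum>T\<in>?\<S>. a T * E_rgg n d p (centred p T))"
    unfolding poly by (rule E_rgg_sum[OF d])
  also have "\<dots> = a {} + (\<Sum>T\<in>?\<T>. a T * E_rgg n d p (centred p T))"
    using fin e unfolding \<T>[symmetric]
    by (subst sum.remove[of _ "{}"]) (auto simp: centred_def[abs_def] E_rgg_const)
  finally have diff: "E_rgg n d p (edge_poly n D c) - E_gnp n p (edge_poly n D c) =
      (\<Sum>T\<in>?\<T>. a T * E_rgg n d p (centred p T))" by (simp add: Eg)
  have normalise: "(\<Sum>T\<in>?\<T>. a T * E_rgg n d p (centred p T)) =
      (\<Sum>T\<in>?\<T>. (a T * sqrt \<sigma> ^ card T) * (E_rgg n d p (centred p T) / sqrt \<sigma> ^ card T))"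
    using \<sigma> by (intro sum.cong) auto
  have "(E_rgg n d p (edge_poly n D c) - E_gnp n p (edge_poly n D c))\<^sup>2 \<le>
      (\<Sum>T\<in>?\<T>. (a T * sqrt \<sigma> ^ card T)\<^sup>2) * (\<Sum>T\<in>?\<T>. (E_rgg n d p (centred p T) / sqrt \<sigma> ^ card T)\<^sup>2)"
    unfolding diff normalise by (rule Cauchy_Schwarz_ineq_sum)
  also have "(\<Sum>T\<in>?\<T>. (a T * sqrt \<sigma> ^ card T)\<^sup>2) = Var_gnp n p (edge_poly n D c)"
    unfolding V using \<sigma>
    by (intro sum.cong refl) (simp add: power_mult_distrib power_mult[symmetric] mult.commute[of _ 2] power_mult)
  also have "(\<Sum>T\<in>?\<T>. (E_rgg n d p (centred p T) / sqrt \<sigma> ^ card T)\<^sup>2) =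
      (\<Sum>T\<in>?\<T>. (E_rgg n d p (centred p T))\<^sup>2 / (p * (1 - p)) ^ card T)"
    unfolding \<sigma>_def[symmetric] using \<sigma>
    by (intro sum.cong refl) (simp add: power_divide power_mult[symmetric] mult.commute[of _ 2] power_mult)
  also have "Var_gnp n p (edge_poly n D c) * \<dots> \<le> Var_gnp n p (edge_poly n D c) * \<eta>\<^sup>2"
    using adv \<sigma> unfolding V by (intro mult_left_mono sum_nonneg) auto
  also have "\<dots> \<le> (Var_gnp n p (edge_poly n D c) + Var_rgg n d p (edge_poly n D c)) * \<eta>\<^sup>2"
    using Var_rgg_nonneg[OF d] by (intro mult_right_mono) auto
  finally have "\<bar>E_rgg n d p (edge_poly n D c) - E_gnp n p (edge_poly n D c)\<bar> \<le>
      sqrt ((Var_gnp n p (edge_poly n D c) + Var_rgg n d p (edge_poly n D c)) * \<eta>\<^sup>2)"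
    by (rule real_le_rsqrt[of "\<bar>_\<bar>", simplified])
  then show ?thesis using \<open>\<eta> \<ge> 0\<close> by (simp add: real_sqrt_mult mult.commute)
qed

text \<open>After normalisation each edge costs \<open>p / (1 - p) \<le> 2 * p \<le> 1\<close>, and
  a leafless graph has at least as many edges as vertices, so \<open>2 * p\<close> can be charged
  per vertex. Together with the squared coefficient bound this gives a sum over leafless graphs of a
  fixed base to the power of the vertex count.\<close>

lemma advantage_bound:
  assumes d: "d > 0" and p: "0 < p" "p \<le> 1/2" and D: "D \<ge> 1" "D \<le> (real s)\<^sup>2"
    and q: "q = 1 - root d p" "q \<le> 1/3"
    and L: "L \<ge> 1" "real d * q \<le> L" "sqrt q * (16 * L * D) ^ s \<le> 1"
  shows "(\<Sum>T | T \<subseteq> all_edges n \<and> real (card T) \<le> D \<and> T \<noteq> {}.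
      (E_rgg n d p (centred p T))\<^sup>2 / (p * (1 - p)) ^ card T) \<le>
    (exp 1)\<^sup>2 * (exp (real n * ((2 * p * (q * ((16 * L * D) ^ s)\<^sup>2)) * (exp 1 * (D\<^sup>2) ^ s))) - 1)"
proof -
  have q0: "0 < q" using d p by (simp add: q(1))
  let ?Y = "(16 * L * D) ^ s"
  let ?x = "2 * p * (q * ?Y\<^sup>2)"
  let ?\<T> = "{T. T \<subseteq> all_edges n \<and> real (card T) \<le> D \<and> T \<noteq> {}}"
  have fin: "finite ?\<T>" by (rule finite_subset[of _ "Pow (all_edges n)"]) auto
  define \<beta> where "\<beta> T = gamma n q T / (1 - q) ^ card T" for T
  have \<beta>_bound: "\<bar>\<beta> T\<bar> \<le> 8 ^ card T * sqrt q ^ (card (verts T) + 2)"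
    if "T \<subseteq> all_edges n" "leafless T" "T \<noteq> {}" for T
  proof -
    \<comment> \<open>Here \<open>1 / (1 - q) \<le> 2\<close>, so the constant 4 of
      \<open>abs_gamma_leafless\<close> becomes 8.\<close>
    have "\<bar>\<beta> T\<bar> = \<bar>gamma n q T\<bar> * (1 / (1 - q)) ^ card T"
      using q by (simp add: \<beta>_def power_divide)
    also have "\<dots> \<le> (4 ^ card T * sqrt q ^ (card (verts T) + 2)) * 2 ^ card T"
      using q q0 that by (intro mult_mono power_mono abs_gamma_leafless) (auto simp: field_simps)
    also have "\<dots> = 8 ^ card T * sqrt q ^ (card (verts T) + 2)"
      by (simp add: power_mult_distrib[symmetric] mult_ac)
    finally show ?thesis .
  qed
  have \<beta>_empty: "\<beta> {} = 1"
  proof -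
    interpret prob_space "PiM {..<n} (\<lambda>_. circle)" by (rule prob_space_PiM_circle)
    show ?thesis using prob_space by (simp add: \<beta>_def gamma_def)
  qed
  have coeff: "(E_rgg n d p (centred p T))\<^sup>2 / (p * (1 - p)) ^ card T \<le>
      (if leafless T then (exp 1)\<^sup>2 * ?x ^ card (verts T) else 0)" if T: "T \<in> ?\<T>" for T
  proof -
    define A where "A = (\<Sum>S\<in>Pow T. (-1) ^ (card T - card S) * (\<Sum>U\<in>Pow S. \<beta> U) ^ d)"
    let ?v = "card (verts T)"
    have fT: "finite T" using T finite_subset_all_edges by auto
    have E: "E_rgg n d p (centred p T) = p ^ card T * A"
      unfolding centred_def[abs_def] A_def \<beta>_def q(1) using E_rgg_centred[OF d, of p T n] p T by auto
    have A: "(\<not> leafless T \<longrightarrow> A = 0) \<and> \<bar>A\<bar> \<le> exp 1 * (sqrt q * ?Y) ^ ?v"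
      unfolding A_def
    proof (rule mobius_power_bound[OF fT])
      show "\<beta> U = 0" if "U \<subseteq> T" "\<not> leafless U" for U
        using gamma_leaf[of q U n] that T q q0 by (auto simp: \<beta>_def)
      show "\<bar>\<beta> U\<bar> \<le> 8 ^ card U * sqrt q ^ (card (verts U) + 2)"
        if "U \<subseteq> T" "leafless U" "U \<noteq> {}" for U
        using that T by (intro \<beta>_bound) auto
    qed (use T D L q0 \<beta>_empty in auto)
    show ?thesis
    proof (cases "leafless T")
      case False
      then show ?thesis using A E by simp
    next
      case True
      have v: "?v \<le> card T" using fT True by (rule leafless_card_verts_le)
      have "(E_rgg n d p (centred p T))\<^sup>2 / (p * (1 - p)) ^ card T = (p / (1 - p)) ^ card T * \<bar>A\<bar>\<^sup>2"
        unfolding E using p by (simp add: power_mult_distrib power_divide power2_eq_square)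
      also have "\<dots> \<le> (2 * p) ^ ?v * (exp 1 * (sqrt q * ?Y) ^ ?v)\<^sup>2"
      proof (rule mult_mono)
        have "(p / (1 - p)) ^ card T \<le> (2 * p) ^ card T"
          using p by (intro power_mono) (auto simp: field_simps)
        also have "\<dots> \<le> (2 * p) ^ ?v" using p v by (intro power_decreasing) auto
        finally show "(p / (1 - p)) ^ card T \<le> (2 * p) ^ ?v" .
        show "\<bar>A\<bar>\<^sup>2 \<le> (exp 1 * (sqrt q * ?Y) ^ ?v)\<^sup>2" using A by (intro power_mono) auto
      qed (use p in auto)
      also have "(exp 1 * (sqrt q * ?Y) ^ ?v)\<^sup>2 = (exp 1)\<^sup>2 * ((sqrt q * ?Y)\<^sup>2) ^ ?v"
        by (simp only: power_mult_distrib[of "exp 1"] power_mult[symmetric] mult.commute[of 2])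
      also have "(sqrt q * ?Y)\<^sup>2 = q * ?Y\<^sup>2" using q0 by (simp add: power_mult_distrib)
      also have "(2 * p) ^ ?v * ((exp 1)\<^sup>2 * (q * ?Y\<^sup>2) ^ ?v) = (exp 1)\<^sup>2 * ?x ^ ?v"
        by (simp only: power_mult_distrib mult_ac)
      finally show ?thesis using True by simp
    qed
  qed
  have "(\<Sum>T\<in>?\<T>. (E_rgg n d p (centred p T))\<^sup>2 / (p * (1 - p)) ^ card T) \<le>
      (\<Sum>T\<in>?\<T>. if leafless T then (exp 1)\<^sup>2 * ?x ^ card (verts T) else 0)"
    by (rule sum_mono) (rule coeff)
  also have "\<dots> = (\<Sum>T | T \<subseteq> all_edges n \<and> real (card T) \<le> D \<and> T \<noteq> {} \<and> leafless T.
      (exp 1)\<^sup>2 * ?x ^ card (verts T))"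
    using fin by (intro sum.mono_neutral_cong_right) auto
  also have "\<dots> = (exp 1)\<^sup>2 * (\<Sum>T | T \<subseteq> all_edges n \<and> real (card T) \<le> D \<and> T \<noteq> {} \<and> leafless T.
      ?x ^ card (verts T))"
    by (simp only: sum_distrib_left)
  also have "\<dots> \<le> (exp 1)\<^sup>2 * (exp (real n * (?x * (exp 1 * (D\<^sup>2) ^ s))) - 1)"
    using p q0 D by (intro mult_left_mono sum_leafless_bound) auto
  finally show ?thesis .
qed

section \<open>Asymptotic choice of the parameters\<close>

lemma one_minus_root_le:
  assumes "d > 0" "0 < p"
  shows "real d * (1 - root d p) \<le> - ln p"
proof -
  have "1 + ln p / real d \<le> exp (ln p / real d)" by (rule exp_ge_add_one_self)
  also have "\<dots> = root d p" using assms by (simp add: root_powr_inverse powr_def)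
  finally show ?thesis using assms by (simp add: field_simps)
qed

text \<open>With t = n * p, the assumed dimension gives a gain exp((ln t) ^ (7/8)), where ln t >=
  \<epsilon> * L. The counting losses are exp(O(L ^ (5/8) * ln L)), since 5/8 is half the exponent
  5/4 of the degree bound. \<open>Z\<close> is an explicit bound for the resulting exponent.\<close>

lemma advantage_at:
  fixes n :: nat
  assumes d: "d > 0" and \<epsilon>: "0 < \<epsilon>" and p: "real n powr (-1 + \<epsilon>) \<le> p" "p \<le> 1/2"
    and dim: "(real n * p) powr (1 + ln (real n * p) powr (-1/8)) \<le> real d"
    and L: "L = ln (real n)" "L \<ge> 1" "1 < real n powr \<epsilon>"
    and D: "1 \<le> D" "D \<le> L powr (5/4)"
    and Z: "Z = 2 * exp 1 * L * (16 * L powr (7/2)) powr (2 * L powr (5/8) + 2) * exp (- ((\<epsilon> * L) powr (7/8)))"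
      "Z \<le> 1/3" "(exp 1)\<^sup>2 * (exp Z - 1) \<le> \<eta>\<^sup>2" "\<eta> \<ge> 0"
  shows "\<bar>E_rgg n d p (edge_poly n D c) - E_gnp n p (edge_poly n D c)\<bar>
    \<le> \<eta> * sqrt (Var_gnp n p (edge_poly n D c) + Var_rgg n d p (edge_poly n D c))"
proof -
  define q where "q = 1 - root d p"
  \<comment> \<open>The least natural number whose square reaches \<open>D\<close>; the rounding
    accounts for the \<open>+ 2\<close> in the exponent inside \<open>Z\<close>.\<close>
  define s where "s = nat \<lceil>sqrt D\<rceil>"
  define t where "t = real n * p"
  define Y where "Y = (16 * L * D) ^ s"
  have n: "real n > 1" using L by (cases "n = 0"; cases "n = 1") auto
  have p0: "0 < p" using p(1) n by (smt (verit) powr_gt_zero)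
  have q0: "0 < q" using d p0 p by (simp add: q_def)
  have t: "real n powr \<epsilon> \<le> t"
  proof -
    have "real n powr \<epsilon> = real n * real n powr (-1 + \<epsilon>)"
      using n powr_add[of "real n" 1 "-1 + \<epsilon>"] by simp
    also have "\<dots> \<le> t" unfolding t_def using p n by (intro mult_left_mono) auto
    finally show ?thesis .
  qed
  have t1: "t > 1" using t L by linarith
  \<comment> \<open>The product is at most \<open>- ln p\<close>, and p is at least 1 / n.\<close>
  have dq: "real d * q \<le> L"
  proof -
    have "real n powr (-1) \<le> real n powr (-1 + \<epsilon>)" using n \<epsilon> by (intro powr_mono) auto
    then have "ln (real n powr (-1)) \<le> ln p" using p p0 n by (subst ln_le_cancel_iff) auto
    then have "- ln p \<le> L" using n by (simp add: ln_div L)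
    with one_minus_root_le[OF d p0] show ?thesis by (simp add: q_def)
  qed
  have s: "D \<le> (real s)\<^sup>2"
  proof -
    have "sqrt D \<le> real s" unfolding s_def by linarith
    then have "(sqrt D)\<^sup>2 \<le> (real s)\<^sup>2" using D by (intro power_mono) auto
    then show ?thesis using D by simp
  qed
  have s': "real s \<le> L powr (5/8) + 1"
  proof -
    have "sqrt D \<le> sqrt (L powr (5/4))" using D by simp
    also have "\<dots> = L powr (5/8)" by (simp add: powr_half_sqrt[symmetric] powr_powr)
    finally have "sqrt D \<le> L powr (5/8)" .
    moreover have "sqrt D \<ge> 0" using D by simp
    ultimately show ?thesis unfolding s_def by linarith
  qed
  have td: "t * exp ((\<epsilon> * L) powr (7/8)) \<le> real d"
  proof -
    have "\<epsilon> * L = ln (real n powr \<epsilon>)" using n by (simp add: ln_powr L)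
    also have "\<dots> \<le> ln t" using t t1 n by (subst ln_le_cancel_iff) auto
    finally have "(\<epsilon> * L) powr (7/8) \<le> ln t powr (7/8)"
      using \<epsilon> L by (intro powr_mono2) auto
    then have "t * exp ((\<epsilon> * L) powr (7/8)) \<le> t * exp (ln t powr (7/8))"
      using t1 by simp
    also have "ln t powr (7/8) = ln t powr (-1/8) * ln t"
    proof -
      have "ln t powr (7/8) = ln t powr (-1/8 + 1)" by simp
      also have "\<dots> = ln t powr (-1/8) * ln t powr 1" by (rule powr_add)
      finally show ?thesis using t1 by simp
    qed
    also have "t * exp (ln t powr (-1/8) * ln t) = t powr (1 + ln t powr (-1/8))"
      using t1 by (simp add: powr_add powr_def[of t])
    also have "\<dots> \<le> real d" using dim by (simp add: t_def)
    finally show ?thesis .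
  qed
  have tq: "t * q \<le> L * exp (- ((\<epsilon> * L) powr (7/8)))"
  proof -
    have "t * exp ((\<epsilon> * L) powr (7/8)) * q \<le> real d * q" using td q0 by (intro mult_right_mono) auto
    also have "\<dots> \<le> L" by (rule dq)
    finally show ?thesis by (simp add: exp_minus field_simps)
  qed
  have Ypos: "Y \<ge> 1" unfolding Y_def
  proof (rule one_le_power)
    have "1 * 1 \<le> (16 * L) * D" using L D by (intro mult_mono) auto
    then show "1 \<le> 16 * L * D" by simp
  qed
  have D2: "(D\<^sup>2) ^ s \<ge> 1" using D by (intro one_le_power) auto
  \<comment> \<open>The exponent 7/2 is 1 + 5/4 + 5/4, from one factor \<open>L\<close> and two
    factors \<open>D\<close> in the common base \<open>16 * L * D * D\<close>.\<close>
  have YD: "Y\<^sup>2 * (D\<^sup>2) ^ s \<le> (16 * L powr (7/2)) powr (2 * L powr (5/8) + 2)"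
  proof -
    have LD: "16 * L * D * D \<le> 16 * L powr (7/2)"
    proof -
      have "16 * L * D * D \<le> 16 * L * L powr (5/4) * L powr (5/4)"
        using L D by (intro mult_mono) auto
      also have "\<dots> = 16 * (L powr 1 * L powr (5/4) * L powr (5/4))" using L by simp
      also have "\<dots> = 16 * L powr (7/2)" by (simp only: powr_add[symmetric]) simp
      finally show ?thesis .
    qed
    have LD1: "1 \<le> 16 * L powr (7/2)"
    proof -
      have "1 \<le> L powr (7/2)" using L by (intro ge_one_powr_ge_zero) auto
      then show ?thesis by simp
    qed
    have "Y\<^sup>2 * (D\<^sup>2) ^ s = (16 * L * D * D) ^ (2 * s)"
      by (simp add: Y_def power_mult_distrib power_mult[symmetric] mult_ac)
    also have "\<dots> \<le> (16 * L powr (7/2)) ^ (2 * s)" using LD L D by (intro power_mono) auto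
    also have "\<dots> = (16 * L powr (7/2)) powr (2 * real s)"
      using L(2) by (subst powr_realpow[symmetric]) auto
    also have "\<dots> \<le> (16 * L powr (7/2)) powr (2 * L powr (5/8) + 2)"
      using LD1 s' by (intro powr_mono) auto
    finally show ?thesis .
  qed
  let ?\<zeta> = "real n * ((2 * p * (q * Y\<^sup>2)) * (exp 1 * (D\<^sup>2) ^ s))"
  have \<zeta>: "?\<zeta> \<le> Z"
  proof -
    have "?\<zeta> = 2 * exp 1 * (t * q) * (Y\<^sup>2 * (D\<^sup>2) ^ s)" by (simp add: t_def mult_ac)
    also have "\<dots> \<le> 2 * exp 1 * (L * exp (- ((\<epsilon> * L) powr (7/8)))) *
        (16 * L powr (7/2)) powr (2 * L powr (5/8) + 2)"
      by (rule mult_mono[OF mult_left_mono[OF tq] YD]) (use L(2) in auto)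
    finally show ?thesis unfolding Z(1) by (simp only: mult_ac)
  qed
  \<comment> \<open>The remaining factors of \<open>?\<zeta>\<close> are at least 1, so its
    smallness also yields the side conditions \<open>q \<le> 1/3\<close> and
    \<open>sqrt q * Y \<le> 1\<close>.\<close>
  have qY: "q * Y\<^sup>2 \<le> 1/3"
  proof -
    have "1 * 1 * 1 \<le> (2 * exp 1) * t * (D\<^sup>2) ^ s"
    proof (intro mult_mono)
      show "1 \<le> 2 * exp (1::real)" using exp_ge_add_one_self[of "1::real"] by linarith
    qed (use t1 D2 in auto)
    then have "q * Y\<^sup>2 * 1 \<le> q * Y\<^sup>2 * ((2 * exp 1) * t * (D\<^sup>2) ^ s)"
      using q0 by (intro mult_left_mono) auto
    also have "\<dots> = ?\<zeta>" by (simp add: t_def mult_ac)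
    finally show ?thesis using \<zeta> Z(2) by linarith
  qed
  have q3: "q \<le> 1/3"
  proof -
    have "q * 1 \<le> q * Y\<^sup>2" using q0 Ypos by (intro mult_left_mono) auto
    then show ?thesis using qY by linarith
  qed
  have "sqrt q * Y \<le> 1"
  proof -
    have "(sqrt q * Y)\<^sup>2 \<le> 1\<^sup>2" using qY q0 by (simp add: power_mult_distrib)
    then show ?thesis by (rule power2_le_imp_le) simp
  qed
  then have "(\<Sum>T | T \<subseteq> all_edges n \<and> real (card T) \<le> D \<and> T \<noteq> {}.
      (E_rgg n d p (centred p T))\<^sup>2 / (p * (1 - p)) ^ card T) \<le> (exp 1)\<^sup>2 * (exp ?\<zeta> - 1)"
    using advantage_bound[OF d p0 p(2) D(1) s q_def q3 L(2) dq, of n] by (simp add: Y_def)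
  also have "\<dots> \<le> (exp 1)\<^sup>2 * (exp Z - 1)" using \<zeta> by (intro mult_left_mono diff_right_mono) auto
  also have "\<dots> \<le> \<eta>\<^sup>2" by (rule Z(3))
  finally show ?thesis
    using d p0 p D Z(4) by (intro low_degree_advantage) auto
qed

theorem theorem1p4:
  fixes \<epsilon> :: real
  assumes "\<epsilon> > 0"
  shows "\<exists>f\<^sub>\<epsilon> :: real \<Rightarrow> real. (f\<^sub>\<epsilon> \<longlongrightarrow> 0) at_top \<and>
    (\<forall>(\<delta>::real) (p::nat \<Rightarrow> real) (d::nat \<Rightarrow> nat). \<delta> > 0 \<longrightarrow>
       (\<forall>\<^sub>F n in sequentially. real n powr (-1 + \<epsilon>) \<le> p n \<and> p n \<le> 1/2
           \<and> real n powr \<delta> \<le> real (d n)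
           \<and> (real n * p n) powr (1 + f\<^sub>\<epsilon> (real n * p n)) \<le> real (d n)) \<longrightarrow>
       (\<forall>\<eta>>0. \<forall>\<^sub>F n in sequentially. \<forall>c. 
           \<bar>E_rgg n (d n) (p n) (edge_poly n (low_deg n) c)
              - E_gnp n (p n) (edge_poly n (low_deg n) c)\<bar>
           \<le> \<eta> * sqrt (Var_gnp n (p n) (edge_poly n (low_deg n) c)
                        + Var_rgg n (d n) (p n) (edge_poly n (low_deg n) c))))"
proof (intro exI[of _ "\<lambda>t. ln t powr (-1/8)"] conjI allI impI)
  \<comment> \<open>The exponent must be negative for the function to vanish at infinity, and above
    -3/8 so that its sum with 1 exceeds the 5/8 of the counting losses.\<close>
  show "((\<lambda>t::real. ln t powr (-1/8)) \<longlongrightarrow> 0) at_top" by real_asymp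
next
  fix \<delta> :: real and p :: "nat \<Rightarrow> real" and d :: "nat \<Rightarrow> nat" and \<eta> :: real
  assume "\<delta> > 0" "\<eta> > 0"
    and hyp: "\<forall>\<^sub>F n in sequentially. real n powr (-1 + \<epsilon>) \<le> p n \<and> p n \<le> 1/2
      \<and> real n powr \<delta> \<le> real (d n)
      \<and> (real n * p n) powr (1 + ln (real n * p n) powr (-1/8)) \<le> real (d n)"
  define Z where "Z L = 2 * exp 1 * L * (16 * L powr (7/2)) powr (2 * L powr (5/8) + 2)
    * exp (- ((\<epsilon> * L) powr (7/8)))" for L :: real
  have ln_n: "filterlim (\<lambda>n. ln (real n)) at_top sequentially" by real_asymp
  \<comment> \<open>The logarithm of \<open>Z L\<close> is O(L ^ (5/8) * ln L) minus a positive
    multiple of L ^ (7/8).\<close>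
  have "(Z \<longlongrightarrow> 0) at_top" unfolding Z_def using \<open>\<epsilon> > 0\<close> by real_asymp
  then have Z0: "((\<lambda>n. Z (ln (real n))) \<longlongrightarrow> 0) sequentially"
    using ln_n by (rule filterlim_compose)
  then have lim: "((\<lambda>n. (exp 1)\<^sup>2 * (exp (Z (ln (real n))) - 1)) \<longlongrightarrow> (exp 1)\<^sup>2 * (exp 0 - 1)) sequentially"
    by (intro tendsto_intros)
  have "\<forall>\<^sub>F n in sequentially. (exp 1)\<^sup>2 * (exp (Z (ln (real n))) - 1) < \<eta>\<^sup>2"
    using \<open>\<eta> > 0\<close> by (intro order_tendstoD(2)[OF lim]) auto
  moreover have "\<forall>\<^sub>F n in sequentially. Z (ln (real n)) < 1/3"
    using Z0 by (intro order_tendstoD) auto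
  moreover have "\<forall>\<^sub>F n in sequentially. 1 \<le> ln (real n)" by real_asymp
  moreover have "\<forall>\<^sub>F n in sequentially. 1 < real n powr \<epsilon>" using \<open>\<epsilon> > 0\<close> by real_asymp
  moreover have "\<forall>\<^sub>F n in sequentially. 1 \<le> low_deg n" unfolding low_deg_def by real_asymp
  moreover have "\<forall>\<^sub>F n in sequentially. low_deg n \<le> ln (real n) powr (5/4)"
    unfolding low_deg_def by real_asymp
  moreover have "\<forall>\<^sub>F n in sequentially. 0 < real n powr \<delta>" using \<open>\<delta> > 0\<close> by real_asymp
  ultimately show "\<forall>\<^sub>F n in sequentially. \<forall>c.
      \<bar>E_rgg n (d n) (p n) (edge_poly n (low_deg n) c) - E_gnp n (p n) (edge_poly n (low_deg n) c)\<bar>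
      \<le> \<eta> * sqrt (Var_gnp n (p n) (edge_poly n (low_deg n) c) + Var_rgg n (d n) (p n) (edge_poly n (low_deg n) c))"
    using hyp
  proof eventually_elim
    case (elim n)
    have "d n > 0" using elim by (metis of_nat_0_less_iff less_le_trans)
    from advantage_at[OF this \<open>\<epsilon> > 0\<close>, of n "p n" "ln (real n)" "low_deg n" "Z (ln (real n))" \<eta>]
    show ?case using elim \<open>\<eta> > 0\<close> by (simp add: Z_def)
  qed
qed

end
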